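(* Let $E$ and $F$ be Banach spaces, $1\le p<\infty$ and $m\in\mathbb N$. A homogeneous polynomial $P\in\mathcal P(^mE;F)$ is $p$-compact if and only if its transpose $P'\in\mathcal L(F';\mathcal P(^mE))$ is quasi $p$-nuclear, and $\kappa_p(P)=\nu_p^Q(P')$.
   Context: Banach spaces are complex; $B_E$ is the closed unit ball of $E$. $\mathcal P(^mE;F)$ is the space of continuous $m$-homogeneous polynomials from $E$ to $F$ with the supremum norm on $B_E$; $\mathcal P(^mE)$ is the scalar-valued case. The transpose (adjoint) of $P$ is the linear operator $P':F'\to\mathcal P(^mE)$, $P'(y')=y'\circ P$. $\ell_p(F)$ is the Banach space of $p$-summable sequences in $F$ with its natural norm $\|\cdot\|_p$. For $(y_n)_n\in\ell_p(F)$ put $p\text{-co}\{y_n\}=\{\sum_n\alpha_ny_n:(\alpha_n)_n\in B_{\ell_q}\}$, $\frac1p+\frac1q=1$. A set $K\subset F$ is relatively $p$-compact if it is contained in the closure of $p\text{-co}\{y_n\}$ for some $(y_n)_n\in\ell_p(F)$, and $m_p(K)=\inf\{\|(y_n)_n\|_p:K\subset p\text{-co}\{y_n\}\}$. $P$ is $p$-compact if $P(B_E)$ is relatively $p$-compact; then $\kappa_p(P)=m_p(P(B_E))$. A bounded linear operator $T:X\to Y$ between Banach spaces is quasi $p$-nuclear if (equivalently to $j_YT$ being $p$-nuclear for the natural isometric embedding $j_Y:Y\to\ell_\infty(B_{Y'})$) there is $(x_n')_n\in\ell_p(X')$ with $\|Tx\|\le(\sum_n|x_n'(x)|^p)^{1/p}$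 for all $x\in X$; its quasi $p$-nuclear norm $\nu_p^Q(T)$ is the infimum of $\|(x_n')_n\|_p$ over all such sequences. *)

theory Defs
  imports "HOL-Analysis.Analysis"
begin

class complex_normed_vector = real_normed_vector +
  fixes scaleC :: "complex \<Rightarrow> 'a \<Rightarrow> 'a"  (infixr "*\<^sub>C" 75)
  assumes scaleC_add_right: "c *\<^sub>C (x + y) = c *\<^sub>C x + c *\<^sub>C y"
    and scaleC_add_left: "(c + d) *\<^sub>C x = c *\<^sub>C x + d *\<^sub>C x"
    and scaleC_scaleC: "c *\<^sub>C d *\<^sub>C x = (c * d) *\<^sub>C x"
    and scaleC_of_real: "complex_of_real r *\<^sub>C x = r *\<^sub>R x"
    and norm_scaleC: "norm (c *\<^sub>C x) = cmod c * norm x"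

class complex_banach = complex_normed_vector + banach

instantiation complex :: complex_banach
begin

definition scaleC_complex :: "complex \<Rightarrow> complex \<Rightarrow> complex"
  where "scaleC_complex c x = c * x"

instance
  by standard (auto simp: scaleC_complex_def algebra_simps norm_mult scaleR_conv_of_real)

end

lemma scaleC_one [simp]: "1 *\<^sub>C x = (x :: 'a::complex_normed_vector)"
  using scaleC_of_real[of 1 x] by simp

lemma scaleC_minus_right:
  fixes x y :: "'a::complex_normed_vector"
  shows "c *\<^sub>C (- x) = - (c *\<^sub>C x)" "c *\<^sub>C (x - y) = c *\<^sub>C x - c *\<^sub>C y"
proof -
  show 1: "c *\<^sub>C (- x) = - (c *\<^sub>C x)" for x :: 'a
    using scaleC_scaleC[of c "of_real (- 1)" x] scaleC_scaleC[of "of_real (- 1)" c x]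
    unfolding scaleC_of_real by (simp add: mult.commute)
  show "c *\<^sub>C (x - y) = c *\<^sub>C x - c *\<^sub>C y"
    using scaleC_add_right[of c x "- y"] 1 by simp
qed

lemma scaleC_scaleR_commute:
  fixes x :: "'a::complex_normed_vector"
  shows "c *\<^sub>C (r *\<^sub>R x) = r *\<^sub>R (c *\<^sub>C x)"
  by (simp add: scaleC_of_real[symmetric] scaleC_scaleC mult.commute)

definition clinear :: "('a::complex_normed_vector \<Rightarrow> 'b::complex_normed_vector) \<Rightarrow> bool"
  where "clinear f \<longleftrightarrow> (\<forall>x y. f (x + y) = f x + f y) \<and> (\<forall>c x. f (c *\<^sub>C x) = c *\<^sub>C f x)"

lemma clinear_imp_linear: "clinear f \<Longrightarrow> linear f"
  by (auto simp: clinear_def scaleC_of_real[symmetric] intro!: linearI)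

typedef (overloaded) ('a, 'b) cblinfun
  = "{f :: 'a::complex_normed_vector \<Rightarrow> 'b::complex_normed_vector. clinear f \<and> bounded_linear f}"
  morphisms cblinfun_apply CBlinfun
  by (rule exI[of _ "\<lambda>_. 0"]) (use norm_scaleC[of _ "0::'b"] in \<open>auto simp: clinear_def\<close>)

setup_lifting type_definition_cblinfun

type_synonym 'a cdual = "('a, complex) cblinfun"

lemma cblinfun_eqI: "(\<And>x. cblinfun_apply f x = cblinfun_apply g x) \<Longrightarrow> f = g"
  by transfer auto

lemma bounded_linear_cblinfun: "bounded_linear (cblinfun_apply f)"
  using cblinfun_apply[of f] by simp

lemma clinear_cblinfun: "clinear (cblinfun_apply f)"
  using cblinfun_apply[of f] by simp

instantiation cblinfun :: (complex_normed_vector, complex_normed_vector) complex_normed_vector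
begin

lift_definition zero_cblinfun :: "('a, 'b) cblinfun" is "\<lambda>_. 0"
  using norm_scaleC[of _ "0::'b"] by (auto simp: clinear_def)

lift_definition plus_cblinfun :: "('a, 'b) cblinfun \<Rightarrow> ('a, 'b) cblinfun \<Rightarrow> ('a, 'b) cblinfun"
  is "\<lambda>f g x. f x + g x"
  by (auto simp: clinear_def scaleC_add_right intro: bounded_linear_add)

lift_definition minus_cblinfun :: "('a, 'b) cblinfun \<Rightarrow> ('a, 'b) cblinfun \<Rightarrow> ('a, 'b) cblinfun"
  is "\<lambda>f g x. f x - g x"
  by (auto simp: clinear_def scaleC_minus_right intro: bounded_linear_sub)

lift_definition uminus_cblinfun :: "('a, 'b) cblinfun \<Rightarrow> ('a, 'b) cblinfun"
  is "\<lambda>f x. - f x"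
  by (auto simp: clinear_def scaleC_minus_right intro: bounded_linear_minus)

lift_definition scaleR_cblinfun :: "real \<Rightarrow> ('a, 'b) cblinfun \<Rightarrow> ('a, 'b) cblinfun"
  is "\<lambda>r f x. r *\<^sub>R f x"
  by (auto simp: clinear_def scaleC_scaleR_commute scaleR_add_right
      intro: bounded_linear_scaleR_right[THEN bounded_linear_compose])

lift_definition scaleC_cblinfun :: "complex \<Rightarrow> ('a, 'b) cblinfun \<Rightarrow> ('a, 'b) cblinfun"
  is "\<lambda>c f x. c *\<^sub>C f x"
proof (intro conjI)
  fix c and f :: "'a \<Rightarrow> 'b" assume f: "clinear f \<and> bounded_linear f"
  show cl: "clinear (\<lambda>x. c *\<^sub>C f x)"
    using f by (auto simp: clinear_def scaleC_add_right scaleC_scaleC mult.commute)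
  from f obtain K where K: "norm (f x) \<le> norm x * K" for x
    using bounded_linear.bounded by blast
  show "bounded_linear (\<lambda>x. c *\<^sub>C f x)"
  proof (intro bounded_linear.intro bounded_linear_axioms.intro exI allI)
    show "linear (\<lambda>x. c *\<^sub>C f x)" by (rule clinear_imp_linear[OF cl])
    show "norm (c *\<^sub>C f x) \<le> norm x * (cmod c * K)" for x
      using mult_left_mono[OF K[of x], of "cmod c"] by (simp add: norm_scaleC mult_ac)
  qed
qed

lift_definition norm_cblinfun :: "('a, 'b) cblinfun \<Rightarrow> real" is onorm .

definition dist_cblinfun :: "('a, 'b) cblinfun \<Rightarrow> ('a, 'b) cblinfun \<Rightarrow> real"
  where "dist_cblinfun f g = norm (f - g)"

definition sgn_cblinfun :: "('a, 'b) cblinfun \<Rightarrow> ('a, 'b) cblinfun"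
  where "sgn_cblinfun f = inverse (norm f) *\<^sub>R f"

definition [code del]:
  "(uniformity :: (('a, 'b) cblinfun \<times> ('a, 'b) cblinfun) filter)
    = (INF e\<in>{0<..}. principal {(x, y). dist x y < e})"

definition open_cblinfun :: "('a, 'b) cblinfun set \<Rightarrow> bool"
  where [code del]:
    "open_cblinfun S = (\<forall>x\<in>S. \<forall>\<^sub>F (x', y) in uniformity. x' = x \<longrightarrow> y \<in> S)"

instance
proof
  fix f g h :: "('a, 'b) cblinfun" and r s :: real and c d :: complex
  show "f + g + h = f + (g + h)" by transfer (simp add: add.assoc)
  show "f + g = g + f" by transfer (simp add: add.commute)
  show "0 + f = f" by transfer simp
  show "- f + f = 0" by transfer simp
  show "f - g = f + - g" by transfer simp
  show "r *\<^sub>R (f + g) = r *\<^sub>R f + r *\<^sub>R g" by transfer (simp add: scaleR_add_right)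
  show "(r + s) *\<^sub>R f = r *\<^sub>R f + s *\<^sub>R f" by transfer (simp add: scaleR_add_left)
  show "r *\<^sub>R s *\<^sub>R f = (r * s) *\<^sub>R f" by transfer simp
  show "1 *\<^sub>R f = f" by transfer simp
  show "dist f g = norm (f - g)" by (rule dist_cblinfun_def)
  show "sgn f = inverse (norm f) *\<^sub>R f" by (rule sgn_cblinfun_def)
  show "(uniformity :: (('a, 'b) cblinfun \<times> ('a, 'b) cblinfun) filter)
      = (INF e\<in>{0<..}. principal {(x, y). dist x y < e})"
    by (rule uniformity_cblinfun_def)
  show "open S = (\<forall>x\<in>S. \<forall>\<^sub>F (x', y) in uniformity. x' = x \<longrightarrow> y \<in> S)"
    for S :: "('a, 'b) cblinfun set"
    by (rule open_cblinfun_def)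
  show "norm f = 0 \<longleftrightarrow> f = 0" by transfer (auto simp: onorm_eq_0)
  show "norm (f + g) \<le> norm f + norm g" by transfer (simp add: onorm_triangle)
  show "norm (r *\<^sub>R f) = \<bar>r\<bar> * norm f" by transfer (simp add: onorm_scaleR)
  show "c *\<^sub>C (f + g) = c *\<^sub>C f + c *\<^sub>C g" by transfer (simp add: scaleC_add_right)
  show "(c + d) *\<^sub>C f = c *\<^sub>C f + d *\<^sub>C f" by transfer (simp add: scaleC_add_left)
  show "c *\<^sub>C d *\<^sub>C f = (c * d) *\<^sub>C f" by transfer (simp add: scaleC_scaleC)
  show "complex_of_real r *\<^sub>C f = r *\<^sub>R f" by transfer (simp add: scaleC_of_real)
  have le: "norm (c *\<^sub>C f) \<le> cmod c * norm f" for c and f :: "('a, 'b) cblinfun"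
  proof transfer
    fix c and f :: "'a \<Rightarrow> 'b" assume f: "clinear f \<and> bounded_linear f"
    show "onorm (\<lambda>x. c *\<^sub>C f x) \<le> cmod c * onorm f"
    proof (rule onorm_bound)
      show "0 \<le> cmod c * onorm f" using f by (simp add: onorm_pos_le)
      show "norm (c *\<^sub>C f x) \<le> cmod c * onorm f * norm x" for x
        using mult_left_mono[OF onorm[of f x], of "cmod c"] f by (simp add: norm_scaleC mult.assoc)
    qed
  qed
  show "norm (c *\<^sub>C f) = cmod c * norm f"
  proof (cases "c = 0")
    case True
    have "0 *\<^sub>C f = 0"
      by transfer (use norm_scaleC[of 0 "_ :: 'b"] in auto)
    moreover have "norm (0 :: ('a, 'b) cblinfun) = 0"
      by transfer (simp add: onorm_zero)
    ultimately show ?thesis using True by simp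
  next
    case False
    have "inverse c *\<^sub>C c *\<^sub>C f = (inverse c * c) *\<^sub>C f"
      by transfer (simp add: scaleC_scaleC)
    also have "\<dots> = 1 *\<^sub>C f"
      using False by simp
    also have "\<dots> = f"
      by transfer simp
    finally have "inverse c *\<^sub>C c *\<^sub>C f = f" .
    then have "norm f \<le> inverse (cmod c) * norm (c *\<^sub>C f)"
      using le[of "inverse c" "c *\<^sub>C f"] by (simp add: norm_inverse)
    then have "cmod c * norm f \<le> norm (c *\<^sub>C f)"
      using False by (simp add: field_simps)
    with le[of c f] show ?thesis by simp
  qed
qed

end

text \<open>An \<open>m\<close>-tuple of vectors is a function on a finite type \<open>'m\<close> with \<open>m = CARD('m)\<close>.\<close>

definition cmultilinear ::
    "(('m::finite \<Rightarrow> 'a::complex_normed_vector) \<Rightarrow> 'b::complex_normed_vector) \<Rightarrow> bool"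
  where "cmultilinear A \<longleftrightarrow> (\<forall>v i. clinear (\<lambda>x. A (v(i := x))))"

typedef (overloaded) ('m, 'a, 'b) hom_poly
  = "{P :: 'a::complex_normed_vector \<Rightarrow> 'b::complex_normed_vector.
        continuous_on UNIV P \<and>
        (\<exists>A :: ('m::finite \<Rightarrow> 'a) \<Rightarrow> 'b. cmultilinear A \<and> (\<forall>x. P x = A (\<lambda>_. x)))}"
  morphisms poly_apply Hom_poly
  by (rule exI[of _ "\<lambda>_. 0"])
    (use norm_scaleC[of _ "0::'b"] in \<open>auto simp: cmultilinear_def clinear_def
      intro!: exI[of _ "\<lambda>_. 0"]\<close>)

setup_lifting type_definition_hom_poly

lemma hom_poly_eqI: "(\<And>x. poly_apply P x = poly_apply Q x) \<Longrightarrow> P = Q"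
  by transfer auto

lemma cmultilinear_diagonal:
  fixes A :: "('m::finite \<Rightarrow> 'a::complex_normed_vector) \<Rightarrow> 'b::complex_normed_vector"
  assumes "cmultilinear A"
  shows "A (\<lambda>_. c *\<^sub>C x) = c ^ CARD('m) *\<^sub>C A (\<lambda>_. x)"
proof -
  have "A (\<lambda>i. if i \<in> S then c *\<^sub>C x else x) = c ^ card S *\<^sub>C A (\<lambda>_. x)" for S
    using finite[of S]
  proof (induction S rule: finite_induct)
    case empty
    show ?case by simp
  next
    case (insert j S)
    let ?v = "\<lambda>i. if i \<in> S then c *\<^sub>C x else x"
    have 1: "(\<lambda>i. if i \<in> insert j S then c *\<^sub>C x else x) = ?v(j := c *\<^sub>C x)"
      by auto
    have 2: "?v(j := x) = ?v"
      using insert.hyps by auto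
    have "A (?v(j := c *\<^sub>C x)) = c *\<^sub>C A (?v(j := x))"
      using assms unfolding cmultilinear_def clinear_def by blast
    then show ?case
      using insert unfolding 1 2 by (simp add: scaleC_scaleC)
  qed
  from this[of UNIV] show ?thesis by simp
qed

lemma poly_apply_scaleC:
  fixes P :: "('m::finite, 'a::complex_normed_vector, 'b::complex_normed_vector) hom_poly"
  shows "poly_apply P (c *\<^sub>C x) = c ^ CARD('m) *\<^sub>C poly_apply P x"
  by transfer (auto simp: cmultilinear_diagonal)

lemma continuous_poly_apply: "continuous_on UNIV (poly_apply P)"
  by transfer auto

lemma poly_apply_zero:
  fixes P :: "('m::finite, 'a::complex_normed_vector, 'b::complex_normed_vector) hom_poly"
  shows "poly_apply P 0 = 0"
proof -
  have "norm (poly_apply P (0 *\<^sub>C 0)) = 0"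
    unfolding poly_apply_scaleC norm_scaleC by simp
  moreover have "norm (0 *\<^sub>C (0::'a)) = 0"
    by (simp only: norm_scaleC) simp
  ultimately show ?thesis by simp
qed

lemma poly_apply_bound:
  fixes P :: "('m::finite, 'a::complex_normed_vector, 'b::complex_normed_vector) hom_poly"
  shows "\<exists>C. \<forall>x\<in>cball 0 1. norm (poly_apply P x) \<le> C"
proof -
  have "isCont (poly_apply P) 0"
    using continuous_poly_apply[of P] by (simp add: continuous_on_eq_continuous_at)
  then obtain d where d: "d > 0" "\<And>x. norm x < d \<Longrightarrow> norm (poly_apply P x) < 1"
    unfolding continuous_at_eps_delta
    by (metis zero_less_one dist_0_norm dist_commute poly_apply_zero)
  define r where "r = d / 2"
  have r: "r > 0" "r < d" using d by (auto simp: r_def)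
  have "norm (poly_apply P x) \<le> inverse (r ^ CARD('m))" if "x \<in> cball 0 1" for x
  proof -
    have "norm (complex_of_real r *\<^sub>C x) < d"
      using that r mult_left_le[of "norm x" r] le_less_trans[of "r * norm x" r d]
      by (simp add: norm_scaleC)
    then have "norm (poly_apply P (complex_of_real r *\<^sub>C x)) < 1"
      by (rule d)
    then have "r ^ CARD('m) * norm (poly_apply P x) < 1"
      using r by (simp add: poly_apply_scaleC norm_scaleC norm_power)
    then show ?thesis using r by (simp add: field_simps)
  qed
  then show ?thesis by blast
qed

lemma bdd_above_poly_apply: "bdd_above ((\<lambda>x. norm (poly_apply P x)) ` cball 0 1)"
  using poly_apply_bound[of P] by (auto intro: bdd_aboveI)

instantiation hom_poly ::
  (finite, complex_normed_vector, complex_normed_vector) complex_normed_vector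
begin

lift_definition zero_hom_poly :: "('a, 'b, 'c) hom_poly" is "\<lambda>_. 0"
  using norm_scaleC[of _ "0::'c"]
  by (auto simp: cmultilinear_def clinear_def intro!: exI[of _ "\<lambda>_. 0"])

lift_definition plus_hom_poly ::
    "('a, 'b, 'c) hom_poly \<Rightarrow> ('a, 'b, 'c) hom_poly \<Rightarrow> ('a, 'b, 'c) hom_poly"
  is "\<lambda>P Q x. P x + Q x"
proof (elim conjE exE, intro conjI)
  fix P Q :: "'b \<Rightarrow> 'c" and A B :: "('a \<Rightarrow> 'b) \<Rightarrow> 'c"
  assume *: "cmultilinear A" "\<forall>x. P x = A (\<lambda>_. x)" "cmultilinear B" "\<forall>x. Q x = B (\<lambda>_. x)"
  show "\<exists>A :: ('a \<Rightarrow> 'b) \<Rightarrow> 'c. cmultilinear A \<and> (\<forall>x. P x + Q x = A (\<lambda>_. x))"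
    using * by (intro exI[of _ "\<lambda>v. A v + B v"])
      (simp add: cmultilinear_def clinear_def scaleC_add_right)
qed (auto intro: continuous_intros)

lift_definition scaleC_hom_poly ::
    "complex \<Rightarrow> ('a, 'b, 'c) hom_poly \<Rightarrow> ('a, 'b, 'c) hom_poly"
  is "\<lambda>c P x. c *\<^sub>C P x"
proof (elim conjE exE, intro conjI)
  fix c and P :: "'b \<Rightarrow> 'c" and A :: "('a \<Rightarrow> 'b) \<Rightarrow> 'c"
  assume *: "cmultilinear A" "\<forall>x. P x = A (\<lambda>_. x)"
  show "\<exists>A :: ('a \<Rightarrow> 'b) \<Rightarrow> 'c. cmultilinear A \<and> (\<forall>x. c *\<^sub>C P x = A (\<lambda>_. x))"
    using * by (intro exI[of _ "\<lambda>v. c *\<^sub>C A v"])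
      (simp add: cmultilinear_def clinear_def scaleC_add_right scaleC_scaleC mult.commute)
  assume P: "continuous_on UNIV P"
  have "bounded_linear (\<lambda>y :: 'c. c *\<^sub>C y)"
    by (rule bounded_linear_intro[of _ "cmod c"])
      (auto simp: scaleC_add_right scaleC_scaleR_commute norm_scaleC)
  from bounded_linear.continuous_on[OF this P]
  show "continuous_on UNIV (\<lambda>x. c *\<^sub>C P x)" .
qed

definition scaleR_hom_poly :: "real \<Rightarrow> ('a, 'b, 'c) hom_poly \<Rightarrow> ('a, 'b, 'c) hom_poly"
  where "scaleR_hom_poly r P = complex_of_real r *\<^sub>C P"

definition uminus_hom_poly :: "('a, 'b, 'c) hom_poly \<Rightarrow> ('a, 'b, 'c) hom_poly"
  where "uminus_hom_poly P = (- 1) *\<^sub>C P"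

definition minus_hom_poly ::
    "('a, 'b, 'c) hom_poly \<Rightarrow> ('a, 'b, 'c) hom_poly \<Rightarrow> ('a, 'b, 'c) hom_poly"
  where "minus_hom_poly P Q = P + - Q"

definition norm_hom_poly :: "('a, 'b, 'c) hom_poly \<Rightarrow> real"
  where "norm_hom_poly P = (SUP x\<in>cball 0 1. norm (poly_apply P x))"

definition dist_hom_poly :: "('a, 'b, 'c) hom_poly \<Rightarrow> ('a, 'b, 'c) hom_poly \<Rightarrow> real"
  where "dist_hom_poly P Q = norm (P - Q)"

definition sgn_hom_poly :: "('a, 'b, 'c) hom_poly \<Rightarrow> ('a, 'b, 'c) hom_poly"
  where "sgn_hom_poly P = inverse (norm P) *\<^sub>R P"

definition [code del]:
  "(uniformity :: (('a, 'b, 'c) hom_poly \<times> ('a, 'b, 'c) hom_poly) filter)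
    = (INF e\<in>{0<..}. principal {(x, y). dist x y < e})"

definition open_hom_poly :: "('a, 'b, 'c) hom_poly set \<Rightarrow> bool"
  where [code del]:
    "open_hom_poly S = (\<forall>x\<in>S. \<forall>\<^sub>F (x', y) in uniformity. x' = x \<longrightarrow> y \<in> S)"

lemma norm_hom_poly_upper: "x \<in> cball 0 1 \<Longrightarrow> norm (poly_apply P x) \<le> norm P"
  unfolding norm_hom_poly_def by (rule cSUP_upper[OF _ bdd_above_poly_apply])

lemma norm_hom_poly_least:
  "(\<And>x. x \<in> cball 0 1 \<Longrightarrow> norm (poly_apply P x) \<le> C) \<Longrightarrow> norm P \<le> C"
  unfolding norm_hom_poly_def by (rule cSUP_least) auto

instance
proof
  fix P Q R :: "('a, 'b, 'c) hom_poly" and r s :: real and c d :: complex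
  show "P + Q + R = P + (Q + R)" by transfer (simp add: add.assoc)
  show PQ: "P + Q = Q + P" for P Q :: "('a, 'b, 'c) hom_poly"
    by transfer (simp add: add.commute)
  show "0 + P = P" by transfer simp
  have m1: "(- 1) *\<^sub>C y = - y" for y :: 'c
    using scaleC_of_real[of "- 1" y] by simp
  show "- P + P = 0"
    unfolding uminus_hom_poly_def by transfer (simp add: m1)
  show "P - Q = P + - Q" by (rule minus_hom_poly_def)
  show add_r: "c *\<^sub>C (P + Q) = c *\<^sub>C P + c *\<^sub>C Q" for c
    by transfer (simp add: scaleC_add_right)
  show add_l: "(c + d) *\<^sub>C P = c *\<^sub>C P + d *\<^sub>C P" for c d
    by transfer (simp add: scaleC_add_left)
  show sc: "c *\<^sub>C d *\<^sub>C P = (c * d) *\<^sub>C P" for c d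
    by transfer (simp add: scaleC_scaleC)
  show "complex_of_real r *\<^sub>C P = r *\<^sub>R P" by (simp add: scaleR_hom_poly_def)
  show "r *\<^sub>R (P + Q) = r *\<^sub>R P + r *\<^sub>R Q" by (simp add: scaleR_hom_poly_def add_r)
  show "(r + s) *\<^sub>R P = r *\<^sub>R P + s *\<^sub>R P" by (simp add: scaleR_hom_poly_def add_l)
  show "r *\<^sub>R s *\<^sub>R P = (r * s) *\<^sub>R P" by (simp add: scaleR_hom_poly_def sc)
  show "1 *\<^sub>R P = P" unfolding scaleR_hom_poly_def by transfer simp
  show "dist P Q = norm (P - Q)" by (rule dist_hom_poly_def)
  show "sgn P = inverse (norm P) *\<^sub>R P" by (rule sgn_hom_poly_def)
  show "(uniformity :: (('a, 'b, 'c) hom_poly \<times> ('a, 'b, 'c) hom_poly) filter)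
      = (INF e\<in>{0<..}. principal {(x, y). dist x y < e})"
    by (rule uniformity_hom_poly_def)
  show "open S = (\<forall>x\<in>S. \<forall>\<^sub>F (x', y) in uniformity. x' = x \<longrightarrow> y \<in> S)"
    for S :: "('a, 'b, 'c) hom_poly set"
    by (rule open_hom_poly_def)
  have apply0: "poly_apply (0 :: ('a, 'b, 'c) hom_poly) x = 0" for x
    by transfer simp
  have norm0: "norm (0 :: ('a, 'b, 'c) hom_poly) = 0"
    unfolding norm_hom_poly_def by (simp add: apply0)
  show "norm P = 0 \<longleftrightarrow> P = 0"
  proof
    assume P: "norm P = 0"
    show "P = 0"
    proof (rule hom_poly_eqI, unfold apply0)
      fix x :: 'b
      define t where "t = inverse (norm x + 1)"
      have "norm x + 1 > 0"
        using norm_ge_zero[of x] by linarith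
      then have t: "t > 0" "t * norm x \<le> 1"
        by (auto simp: t_def field_simps)
      have "poly_apply P (complex_of_real t *\<^sub>C x) = 0"
        using norm_hom_poly_upper[of "complex_of_real t *\<^sub>C x" P] t P by (simp add: norm_scaleC)
      then have "norm (complex_of_real t ^ CARD('a) *\<^sub>C poly_apply P x) = 0"
        by (simp add: poly_apply_scaleC)
      then show "poly_apply P x = 0"
        using t by (simp add: norm_scaleC)
    qed
  qed (simp add: norm0)
  have apply_add: "poly_apply (P + Q) x = poly_apply P x + poly_apply Q x" for x
    by transfer simp
  show "norm (P + Q) \<le> norm P + norm Q"
  proof (rule norm_hom_poly_least)
    fix x :: 'b assume "x \<in> cball 0 1"
    then show "norm (poly_apply (P + Q) x) \<le> norm P + norm Q"
      unfolding apply_add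
      by (intro norm_triangle_le add_mono norm_hom_poly_upper)
  qed
  have apply_scaleC: "poly_apply (c *\<^sub>C P) x = c *\<^sub>C poly_apply P x"
    for c x and P :: "('a, 'b, 'c) hom_poly"
    by transfer simp
  have le: "norm (c *\<^sub>C P) \<le> cmod c * norm P" for c and P :: "('a, 'b, 'c) hom_poly"
    by (rule norm_hom_poly_least)
      (auto simp: apply_scaleC norm_scaleC intro!: mult_left_mono norm_hom_poly_upper)
  show norm_eq: "norm (c *\<^sub>C P) = cmod c * norm P" for c
  proof (cases "c = 0")
    case True
    have "norm (poly_apply (0 *\<^sub>C P) x) = 0" for x
      by (simp only: apply_scaleC norm_scaleC) simp
    then have "0 *\<^sub>C P = 0"
      by (intro hom_poly_eqI) (simp add: apply0)
    then show ?thesis using True norm0 by simp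
  next
    case False
    have "inverse c *\<^sub>C c *\<^sub>C P = (inverse c * c) *\<^sub>C P"
      by transfer (simp add: scaleC_scaleC)
    also have "\<dots> = 1 *\<^sub>C P"
      using False by simp
    also have "\<dots> = P"
      by transfer simp
    finally have "inverse c *\<^sub>C c *\<^sub>C P = P" .
    then have "norm P \<le> inverse (cmod c) * norm (c *\<^sub>C P)"
      using le[of "inverse c" "c *\<^sub>C P"] by (simp add: norm_inverse)
    then have "cmod c * norm P \<le> norm (c *\<^sub>C P)"
      using False by (simp add: field_simps)
    with le[of c P] show ?thesis by simp
  qed
  show "norm (r *\<^sub>R P) = \<bar>r\<bar> * norm P"
    by (simp add: scaleR_hom_poly_def norm_eq)
qed

end

lift_definition poly_compose ::
    "('b::complex_normed_vector, 'c::complex_normed_vector) cblinfun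
      \<Rightarrow> ('m::finite, 'a::complex_normed_vector, 'b) hom_poly \<Rightarrow> ('m, 'a, 'c) hom_poly"
  is "\<lambda>f P x. f (P x)"
proof (elim conjE exE, intro conjI)
  fix f :: "'b \<Rightarrow> 'c" and P :: "'a \<Rightarrow> 'b" and A :: "('m \<Rightarrow> 'a) \<Rightarrow> 'b"
  assume f: "clinear f" "bounded_linear f"
    and P: "continuous_on UNIV P" and A: "cmultilinear A" "\<forall>x. P x = A (\<lambda>_. x)"
  show "continuous_on UNIV (\<lambda>x. f (P x))"
    using bounded_linear.continuous_on[OF f(2) P] .
  show "\<exists>B :: ('m \<Rightarrow> 'a) \<Rightarrow> 'c. cmultilinear B \<and> (\<forall>x. f (P x) = B (\<lambda>_. x))"
    using f A by (intro exI[of _ "\<lambda>v. f (A v)"]) (simp add: cmultilinear_def clinear_def)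
qed

lift_definition poly_transpose ::
    "('m::finite, 'a::complex_normed_vector, 'b::complex_normed_vector) hom_poly
      \<Rightarrow> ('b cdual, ('m, 'a, complex) hom_poly) cblinfun"
  is "\<lambda>P y'. poly_compose y' P"
proof (intro conjI)
  fix P :: "('m, 'a, 'b) hom_poly"
  show cl: "clinear (\<lambda>y' :: 'b cdual. poly_compose y' P)"
    unfolding clinear_def
    by (intro conjI allI hom_poly_eqI; transfer) auto
  show "bounded_linear (\<lambda>y' :: 'b cdual. poly_compose y' P)"
  proof (intro bounded_linear.intro bounded_linear_axioms.intro exI allI)
    show "linear (\<lambda>y' :: 'b cdual. poly_compose y' P)"
      by (rule clinear_imp_linear[OF cl])
    fix y' :: "'b cdual"
    show "norm (poly_compose y' P) \<le> norm y' * norm P"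
    proof (rule norm_hom_poly_least)
      fix x :: 'a assume x: "x \<in> cball 0 1"
      have "norm (cblinfun_apply y' (poly_apply P x)) \<le> norm y' * norm (poly_apply P x)"
        unfolding norm_cblinfun.rep_eq by (rule onorm[OF bounded_linear_cblinfun])
      also have "\<dots> \<le> norm y' * norm P"
        by (intro mult_left_mono norm_hom_poly_upper x) simp
      finally show "norm (poly_apply (poly_compose y' P) x) \<le> norm y' * norm P"
        by (simp add: poly_compose.rep_eq)
    qed
  qed
qed

definition lp :: "real \<Rightarrow> (nat \<Rightarrow> 'a::real_normed_vector) set"
  where "lp p = {y. summable (\<lambda>n. norm (y n) powr p)}"

definition lp_norm :: "real \<Rightarrow> (nat \<Rightarrow> 'a::real_normed_vector) \<Rightarrow> real"
  where "lp_norm p y = (\<Sum>n. norm (y n) powr p) powr (1 / p)"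

text \<open>The closed unit ball of \<open>\<ell>\<^sub>q\<close>, where \<open>q\<close> is the conjugate exponent of \<open>p\<close>; for \<open>p = 1\<close>
  this is the unit ball of \<open>\<ell>\<^sub>\<infinity>\<close>.\<close>

definition conjugate_ball :: "real \<Rightarrow> (nat \<Rightarrow> complex) set"
  where "conjugate_ball p =
    (if p = 1 then {\<alpha>. \<forall>n. cmod (\<alpha> n) \<le> 1}
     else let q = p / (p - 1) in {\<alpha> \<in> lp q. lp_norm q \<alpha> \<le> 1})"

definition p_co :: "real \<Rightarrow> (nat \<Rightarrow> 'a::complex_banach) \<Rightarrow> 'a set"
  where "p_co p y = {\<Sum>n. \<alpha> n *\<^sub>C y n | \<alpha>. \<alpha> \<in> conjugate_ball p}"

definition relatively_p_compact :: "real \<Rightarrow> 'a::complex_banach set \<Rightarrow> bool"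
  where "relatively_p_compact p K \<longleftrightarrow> (\<exists>y \<in> lp p. K \<subseteq> closure (p_co p y))"

text \<open>The infima below are taken in \<open>[0, \<infinity>]\<close>, so that they are \<open>\<infinity>\<close> over the empty set.\<close>

definition m_p :: "real \<Rightarrow> 'a::complex_banach set \<Rightarrow> ennreal"
  where "m_p p K = (INF y \<in> {y \<in> lp p. K \<subseteq> p_co p y}. ennreal (lp_norm p y))"

definition p_compact_poly ::
    "real \<Rightarrow> ('m::finite, 'a::complex_banach, 'b::complex_banach) hom_poly \<Rightarrow> bool"
  where "p_compact_poly p P \<longleftrightarrow> relatively_p_compact p (poly_apply P ` cball 0 1)"

definition kappa_p ::
    "real \<Rightarrow> ('m::finite, 'a::complex_banach, 'b::complex_banach) hom_poly \<Rightarrow> ennreal"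
  where "kappa_p p P = m_p p (poly_apply P ` cball 0 1)"

definition quasi_nuclear_dominating ::
    "real \<Rightarrow> ('a::complex_normed_vector, 'b::complex_normed_vector) cblinfun
      \<Rightarrow> (nat \<Rightarrow> 'a cdual) set"
  where "quasi_nuclear_dominating p T =
    {x' \<in> lp p. \<forall>x. norm (cblinfun_apply T x) \<le> lp_norm p (\<lambda>n. cblinfun_apply (x' n) x)}"

definition quasi_p_nuclear ::
    "real \<Rightarrow> ('a::complex_normed_vector, 'b::complex_normed_vector) cblinfun \<Rightarrow> bool"
  where "quasi_p_nuclear p T \<longleftrightarrow> quasi_nuclear_dominating p T \<noteq> {}"

definition nu_p_Q ::
    "real \<Rightarrow> ('a::complex_normed_vector, 'b::complex_normed_vector) cblinfun \<Rightarrow> ennreal"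
  where "nu_p_Q p T = (INF x' \<in> quasi_nuclear_dominating p T. ennreal (lp_norm p x'))"

end

theory Submission
  imports Defs "HOL-Library.Function_Algebras"
begin

text \<open>Let \<open>K = P(B\<^sub>E)\<close>. If \<open>K\<close> lies in the closure of \<open>p\<close>-co\<open>{y\<^sub>n}\<close>, Hoelder's inequality shows that
  the \<open>y\<^sub>n\<close>, viewed in \<open>F''\<close>, dominate \<open>P'\<close>. Conversely, let \<open>(x''\<^sub>n) \<in> \<ell>\<^sub>p(F'')\<close> dominate \<open>P'\<close>, that is,
  \<open>\<bar>y'(z)\<bar> \<le> \<parallel>(x''\<^sub>n(y'))\<parallel>\<^sub>p\<close> for \<open>z \<in> K\<close>. Hahn-Banach extension on \<open>\<ell>\<^sub>p\<close> gives coefficients \<open>\<alpha>(z)\<close> in the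
  conjugate ball with \<open>z = \<Sum> \<alpha>\<^sub>n(z) x''\<^sub>n\<close> in \<open>F''\<close>, and it remains to replace the \<open>x''\<^sub>n\<close> by vectors of \<open>F\<close> at
  an arbitrarily small cost. For finitely many \<open>z\<close> this is a Helly-type consequence of Hahn-Banach.
  In general, pick finitely many \<open>w \<in> K\<close> whose first \<open>N\<close> coefficients approximate those of every
  \<open>z \<in> K\<close>; the differences \<open>z - w(z)\<close> lie in \<open>F\<close> and are again dominated by a sequence in \<open>F''\<close>, now of
  small norm. Iterating and using that \<open>m\<^sub>p\<close> is countably subadditive yields a sequence in \<open>\<ell>\<^sub>p(F)\<close> of
  norm at most \<open>\<parallel>(x''\<^sub>n)\<parallel>\<^sub>p + \<epsilon>\<close> whose \<open>p\<close>-convex hull contains \<open>K\<close>.\<close>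

section \<open>The Hahn-Banach theorem\<close>

definition sublinear :: "('a::real_vector \<Rightarrow> real) \<Rightarrow> bool"
  where "sublinear q \<longleftrightarrow> (\<forall>x y. q (x + y) \<le> q x + q y) \<and> (\<forall>t\<ge>0. \<forall>x. q (t *\<^sub>R x) = t * q x)"

lemma sublinear_add: "sublinear q \<Longrightarrow> q (x + y) \<le> q x + q y"
  and sublinear_scaleR: "sublinear q \<Longrightarrow> 0 \<le> t \<Longrightarrow> q (t *\<^sub>R x) = t * q x"
  by (auto simp: sublinear_def)

lemma sublinear_zero: "sublinear q \<Longrightarrow> q 0 = 0"
  using sublinear_scaleR[of q 0 0] by simp

lemma sublinear_minus: "sublinear q \<Longrightarrow> - q (- x) \<le> q x"
  using sublinear_add[of q x "- x"] by (simp add: sublinear_zero)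

text \<open>The infimal convolution of \<open>q\<close> with the function sending \<open>w\<close>
  to the infimum of all \<open>r\<close> such that \<open>(w, r) \<in> C\<close>. A cone of pairs
  encodes that function because it may be infinite at most points, for instance off a ray or a
  subspace.\<close>

definition inf_conv :: "('a::real_vector \<Rightarrow> real) \<Rightarrow> ('a \<times> real) set \<Rightarrow> 'a \<Rightarrow> real"
  where "inf_conv q C x = (INF c\<in>C. q (x - fst c) + snd c)"

context
  fixes q :: "'a::real_vector \<Rightarrow> real" and C :: "('a \<times> real) set"
  assumes q: "sublinear q" and C: "convex_cone C"
    and nonneg: "\<And>w r. (w, r) \<in> C \<Longrightarrow> 0 \<le> q (- w) + r"
begin

text \<open>The bound does not depend on \<open>c\<close>, so the infimum in \<open>inf_conv\<close>
  is finite: subadditivity gives \<open>q (- fst c) \<le> q (x - fst c) + q (- x)\<close>, and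
  \<open>nonneg\<close> applies to the left side.\<close>

lemma inf_conv_bound: "c \<in> C \<Longrightarrow> - q (- x) \<le> q (x - fst c) + snd c"
  using sublinear_add[OF q, of "x - fst c" "- x"] nonneg[of "fst c" "snd c"] by simp

lemma inf_conv_lower: "(w, r) \<in> C \<Longrightarrow> inf_conv q C x \<le> q (x - w) + r"
  unfolding inf_conv_def
  by (rule cINF_lower2[where x = "(w, r)"]) (auto intro!: bdd_belowI2 inf_conv_bound)

lemma inf_conv_greatest:
  "(\<And>w r. (w, r) \<in> C \<Longrightarrow> m \<le> q (x - w) + r) \<Longrightarrow> m \<le> inf_conv q C x"
  unfolding inf_conv_def
  by (rule cINF_greatest) (use C in \<open>auto simp: convex_cone_iff\<close>)

lemma inf_conv_le: "inf_conv q C x \<le> q x"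
  using inf_conv_lower[of 0 0 x] C by (simp add: convex_cone_iff zero_prod_def)

lemma inf_conv_less:
  assumes "inf_conv q C x < m"
  obtains w r where "(w, r) \<in> C" "q (x - w) + r < m"
  using assms inf_conv_greatest[of m x] by force

text \<open>Near-optimal pairs for \<open>x\<close> and \<open>y\<close> add up to a competitor for
  \<open>x + y\<close>, since \<open>C\<close> is closed under addition; closure under scaling gives
  homogeneity in the same way.\<close>

lemma sublinear_inf_conv: "sublinear (inf_conv q C)"
  unfolding sublinear_def
proof (intro conjI allI impI)
  fix x y
  show "inf_conv q C (x + y) \<le> inf_conv q C x + inf_conv q C y"
  proof (rule field_le_epsilon)
    fix e :: real assume "e > 0"
    obtain w r where wr: "(w, r) \<in> C" "q (x - w) + r < inf_conv q C x + e / 2"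
      using inf_conv_less[of x "inf_conv q C x + e / 2"] \<open>e > 0\<close> by auto
    obtain v s where vs: "(v, s) \<in> C" "q (y - v) + s < inf_conv q C y + e / 2"
      using inf_conv_less[of y "inf_conv q C y + e / 2"] \<open>e > 0\<close> by auto
    have "(w + v, r + s) \<in> C"
      using convex_cone_add[OF C wr(1) vs(1)] by simp
    from inf_conv_lower[OF this, of "x + y"] sublinear_add[OF q, of "x - w" "y - v"] wr(2) vs(2)
    show "inf_conv q C (x + y) \<le> inf_conv q C x + inf_conv q C y + e"
      by (simp add: algebra_simps)
  qed
next
  \<comment> \<open>Applied also to \<open>inverse t\<close> and \<open>t *\<^sub>R x\<close>, this
    inequality yields equality for positive \<open>t\<close>.\<close>
  have le: "inf_conv q C (t *\<^sub>R x) \<le> t * inf_conv q C x" if "t > 0" for t x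
  proof -
    have "inf_conv q C (t *\<^sub>R x) / t \<le> inf_conv q C x"
    proof (rule inf_conv_greatest)
      fix w r assume "(w, r) \<in> C"
      then have "(t *\<^sub>R w, t * r) \<in> C"
        using convex_cone_scaleR[OF C, of t "(w, r)"] that by simp
      from inf_conv_lower[OF this, of "t *\<^sub>R x"] sublinear_scaleR[OF q, of t "x - w"] that
      show "inf_conv q C (t *\<^sub>R x) / t \<le> q (x - w) + r"
        by (simp add: field_simps scaleR_diff_right)
    qed
    then show ?thesis using that by (simp add: field_simps)
  qed
  fix t :: real and x assume "t \<ge> 0"
  show "inf_conv q C (t *\<^sub>R x) = t * inf_conv q C x"
  proof (cases "t = 0")
    case True
    have "inf_conv q C 0 \<le> 0"
      using inf_conv_le[of 0] sublinear_zero[OF q] by simp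
    moreover have "0 \<le> inf_conv q C 0"
      by (rule inf_conv_greatest) (use nonneg in auto)
    ultimately show ?thesis using True by simp
  next
    case False
    then have "t > 0" using \<open>t \<ge> 0\<close> by simp
    from le[OF this, of x] le[of "inverse t" "t *\<^sub>R x"] this show ?thesis
      by (auto simp: field_simps)
  qed
qed

end

text \<open>Subadditivity rests on the chain condition: if \<open>s\<close> is nearly optimal at
  \<open>x\<close> and \<open>s'\<close> at \<open>y\<close>, the smaller of the two is nearly
  optimal at both points. The function \<open>m\<close> keeps the pointwise infima finite.\<close>

lemma sublinear_INF_chain:
  fixes Q :: "('a::real_vector \<Rightarrow> real) set"
  assumes "Q \<noteq> {}" and sub: "\<And>s. s \<in> Q \<Longrightarrow> sublinear s"
    and chain: "\<And>s s'. s \<in> Q \<Longrightarrow> s' \<in> Q \<Longrightarrow> s \<le> s' \<or> s' \<le> s"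
    and bdd: "\<And>s x. s \<in> Q \<Longrightarrow> m x \<le> s x"
  shows "sublinear (\<lambda>x. INF s\<in>Q. s x)"
proof -
  have lower: "(INF s\<in>Q. s x) \<le> s x" if "s \<in> Q" for s x
    using that bdd by (intro cINF_lower) (auto intro!: bdd_belowI2)
  have less: "\<exists>s\<in>Q. s x < c" if "(INF s\<in>Q. s x) < c" for x c
    using that \<open>Q \<noteq> {}\<close> bdd by (subst (asm) cINF_less_iff) (auto intro!: bdd_belowI2)
  show ?thesis
    unfolding sublinear_def
  proof (intro conjI allI impI)
    fix x y
    show "(INF s\<in>Q. s (x + y)) \<le> (INF s\<in>Q. s x) + (INF s\<in>Q. s y)"
    proof (rule field_le_epsilon)
      fix e :: real assume "e > 0"
      obtain s where s: "s \<in> Q" "s x < (INF s\<in>Q. s x) + e / 2"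
        using less[of x "(INF s\<in>Q. s x) + e / 2"] \<open>e > 0\<close> by auto
      obtain s' where s': "s' \<in> Q" "s' y < (INF s\<in>Q. s y) + e / 2"
        using less[of y "(INF s\<in>Q. s y) + e / 2"] \<open>e > 0\<close> by auto
      obtain r where r: "r \<in> Q" "r \<le> s" "r \<le> s'"
        using chain[OF s(1) s'(1)] s(1) s'(1) by auto
      have "r (x + y) \<le> s x + s' y"
        using sublinear_add[OF sub[OF r(1)], of x y] r(2,3) by (force simp: le_fun_def intro: order_trans add_mono)
      then show "(INF s\<in>Q. s (x + y)) \<le> (INF s\<in>Q. s x) + (INF s\<in>Q. s y) + e"
        using lower[OF r(1), of "x + y"] s(2) s'(2) by linarith
    qed
  next
    fix t :: real and x assume "t \<ge> 0"
    have "(INF s\<in>Q. s (t *\<^sub>R x)) = (INF s\<in>Q. t * s x)"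
      using sub \<open>t \<ge> 0\<close> by (intro INF_cong) (auto simp: sublinear_scaleR)
    also have "\<dots> = t * (INF s\<in>Q. s x)"
    proof (cases "t = 0")
      case False
      then have "t > 0" using \<open>t \<ge> 0\<close> by simp
      show ?thesis
      proof (rule antisym)
        have "(INF s\<in>Q. t * s x) / t \<le> (INF s\<in>Q. s x)"
        proof (rule cINF_greatest[OF \<open>Q \<noteq> {}\<close>])
          fix s assume "s \<in> Q"
          then have "(INF s\<in>Q. t * s x) \<le> t * s x"
            using bdd \<open>t > 0\<close>
            by (intro cINF_lower) (auto intro!: bdd_belowI2[where m = "t * m x"])
          then show "(INF s\<in>Q. t * s x) / t \<le> s x"
            using \<open>t > 0\<close> by (simp add: field_simps)
        qed
        then show "(INF s\<in>Q. t * s x) \<le> t * (INF s\<in>Q. s x)"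
          using \<open>t > 0\<close> by (simp add: field_simps)
        show "t * (INF s\<in>Q. s x) \<le> (INF s\<in>Q. t * s x)"
          using lower \<open>t > 0\<close> by (intro cINF_greatest[OF \<open>Q \<noteq> {}\<close>]) auto
      qed
    qed (use \<open>Q \<noteq> {}\<close> in simp)
    finally show "(INF s\<in>Q. s (t *\<^sub>R x)) = t * (INF s\<in>Q. s x)" .
  qed
qed

text \<open>The absolute value lets all reals parametrize the nonnegative multiples of
  \<open>c\<close>.\<close>

lemma convex_cone_ray: "convex_cone (range (\<lambda>t. \<bar>t\<bar> *\<^sub>R c))" for c :: "'a::real_vector"
  unfolding convex_cone_iff
proof (intro conjI ballI allI impI)
  show "0 \<in> range (\<lambda>t. \<bar>t\<bar> *\<^sub>R c)" by (rule image_eqI[of _ _ 0]) auto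
  fix a b assume "a \<in> range (\<lambda>t. \<bar>t\<bar> *\<^sub>R c)" "b \<in> range (\<lambda>t. \<bar>t\<bar> *\<^sub>R c)"
  then obtain t u where "a = \<bar>t\<bar> *\<^sub>R c" "b = \<bar>u\<bar> *\<^sub>R c" by auto
  then show "a + b \<in> range (\<lambda>t. \<bar>t\<bar> *\<^sub>R c)"
    by (intro image_eqI[of _ _ "\<bar>t\<bar> + \<bar>u\<bar>"]) (auto simp: algebra_simps)
next
  fix a :: 'a and r :: real assume "a \<in> range (\<lambda>t. \<bar>t\<bar> *\<^sub>R c)" "0 \<le> r"
  then obtain t where "a = \<bar>t\<bar> *\<^sub>R c" by auto
  then show "r *\<^sub>R a \<in> range (\<lambda>t. \<bar>t\<bar> *\<^sub>R c)"
    using \<open>0 \<le> r\<close> by (intro image_eqI[of _ _ "r * t"]) (auto simp: abs_mult)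
qed

text \<open>A minimal sublinear functional \<open>s\<close> is linear: lowering it along the ray through
  \<open>(- y, - s(y))\<close> cannot change it, which says \<open>s(x) \<le> s(x + y) - s(y)\<close>.\<close>

theorem sublinear_dominates_linear:
  fixes q :: "'a::real_vector \<Rightarrow> real"
  assumes q: "sublinear q"
  obtains f where "linear f" "f \<le> q"
proof -
  \<comment> \<open>\<open>?R\<close> is the reversed pointwise order, so a maximal element in
    Zorn's lemma is a minimal sublinear functional below \<open>q\<close>.\<close>
  let ?A = "{s. sublinear s \<and> s \<le> q}" and ?R = "\<lambda>s s' :: 'a \<Rightarrow> real. s' \<le> s"
  have "\<exists>s\<in>?A. \<forall>s'\<in>?A. ?R s s' \<longrightarrow> s' = s"
  proof (rule predicate_Zorn)
    show "partial_order_on ?A (relation_of ?R ?A)"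
      by (rule partial_order_on_relation_ofI) auto
    fix Q assume "Q \<in> Chains (relation_of ?R ?A)"
    then have Q: "Q \<subseteq> ?A" "\<And>s s'. s \<in> Q \<Longrightarrow> s' \<in> Q \<Longrightarrow> s \<le> s' \<or> s' \<le> s"
      by (auto simp: Chains_def relation_of_def)
    \<comment> \<open>A lower bound common to all sublinear functionals below \<open>q\<close>, so
      that the infimum of a chain exists.\<close>
    have bdd: "- q (- x) \<le> s x" if "s \<in> Q" for s x
    proof -
      have "sublinear s" "s (- x) \<le> q (- x)"
        using that Q(1) by (auto simp: le_fun_def)
      then show ?thesis using sublinear_minus[of s x] by simp
    qed
    show "\<exists>u\<in>?A. \<forall>s\<in>Q. ?R s u"
    proof (cases "Q = {}")
      case False
      have le: "(\<lambda>x. INF s\<in>Q. s x) \<le> s" if "s \<in> Q" for s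
        unfolding le_fun_def using that bdd
        by (intro allI cINF_lower bdd_belowI2[where m = "- q (- _)"]) auto
      have "sublinear (\<lambda>x. INF s\<in>Q. s x)"
        by (rule sublinear_INF_chain[where m = "\<lambda>x. - q (- x)" and Q = Q])
          (use False Q bdd in blast)+
      then show ?thesis
        using le False Q(1) by (intro bexI[of _ "\<lambda>x. INF s\<in>Q. s x"]) (blast intro: order_trans)+
    qed (use q in auto)
  qed
  then obtain s where s: "sublinear s" "s \<le> q" and min: "\<And>r. sublinear r \<Longrightarrow> r \<le> s \<Longrightarrow> r = s"
    by (auto intro: order_trans)
  have add: "s (x + y) = s x + s y" for x y
  proof -
    let ?C = "range (\<lambda>t. \<bar>t\<bar> *\<^sub>R (- y, - s y))"
    note C = convex_cone_ray[of "(- y, - s y)"]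
    have nonneg: "0 \<le> s (- w) + r" if "(w, r) \<in> ?C" for w r
      using that sublinear_scaleR[OF s(1)] by auto
    have "inf_conv s ?C = s"
      using sublinear_inf_conv[OF s(1) C nonneg] inf_conv_le[OF s(1) C nonneg]
      by (intro min le_funI)
    then have "s x \<le> s (x + y) - s y"
      using inf_conv_lower[OF s(1) C nonneg, of "- y" "- s y" x] by (force intro!: image_eqI[of _ _ 1])
    then show ?thesis using sublinear_add[OF s(1), of x y] by simp
  qed
  have neg: "s (- x) = - s x" for x
    using add[of x "- x"] sublinear_zero[OF s(1)] by simp
  have "s (t *\<^sub>R x) = t * s x" for t x
  proof (cases "t \<ge> 0")
    case False
    then show ?thesis
      using sublinear_scaleR[OF s(1), of "- t" x] neg[of "t *\<^sub>R x"] by simp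
  qed (simp add: sublinear_scaleR[OF s(1)])
  with add have "linear s" by (intro linearI) auto
  with s(2) that show thesis by blast
qed

text \<open>A linear functional below \<open>inf_conv q C\<close> satisfies both bounds: the pair
  \<open>(0, 0)\<close> in \<open>C\<close> gives \<open>f x \<le> q x\<close>, and the pair
  \<open>(w, r)\<close> used at the point \<open>w\<close> itself gives
  \<open>f w \<le> r\<close>.\<close>

theorem Hahn_Banach_convex_cone:
  fixes q :: "'a::real_vector \<Rightarrow> real"
  assumes q: "sublinear q" and C: "convex_cone C"
    and nonneg: "\<And>w r. (w, r) \<in> C \<Longrightarrow> 0 \<le> q (- w) + r"
  obtains f where "linear f" "\<And>x. f x \<le> q x" "\<And>w r. (w, r) \<in> C \<Longrightarrow> f w \<le> r"
proof -
  obtain f where f: "linear f" "f \<le> inf_conv q C"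
    using sublinear_dominates_linear[OF sublinear_inf_conv[OF q C nonneg]] by blast
  show thesis
  proof (rule that[OF f(1)])
    show "f x \<le> q x" for x
      using f(2) inf_conv_le[OF q C nonneg, of x] by (auto simp: le_fun_def intro: order_trans)
    show "f w \<le> r" if "(w, r) \<in> C" for w r
      using f(2) inf_conv_lower[OF q C nonneg that, of w] sublinear_zero[OF q]
      by (auto simp: le_fun_def intro: order_trans)
  qed
qed

text \<open>The cone is the ray through \<open>(- v, - q v)\<close>, on which the constraint says
  \<open>f v \<ge> q v\<close>.\<close>

lemma Hahn_Banach_support:
  fixes q :: "'a::real_vector \<Rightarrow> real"
  assumes q: "sublinear q"
  obtains f where "linear f" "\<And>x. f x \<le> q x" "f v = q v"
proof -
  let ?C = "range (\<lambda>t. \<bar>t\<bar> *\<^sub>R (- v, - q v))"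
  note C = convex_cone_ray[of "(- v, - q v)"]
  have nonneg: "0 \<le> q (- w) + r" if "(w, r) \<in> ?C" for w r
    using that sublinear_scaleR[OF q] by auto
  obtain f where f: "linear f" "\<And>x. f x \<le> q x" "\<And>w r. (w, r) \<in> ?C \<Longrightarrow> f w \<le> r"
    using Hahn_Banach_convex_cone[OF q C nonneg] by blast
  have "f (- v) \<le> - q v"
    by (rule f(3)) (auto intro!: image_eqI[of _ _ 1])
  then have "f v = q v"
    using f(2)[of v] linear_neg[OF f(1), of v] by simp
  with f that show thesis by blast
qed

section \<open>Vector-valued sequence spaces\<close>

lemma lp_norm_nonneg [simp]: "0 \<le> lp_norm p y"
  by (simp add: lp_norm_def)

lemma lp_norm_powr:
  assumes "y \<in> lp p" "0 < p"
  shows "lp_norm p y powr p = (\<Sum>n. norm (y n) powr p)"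
  using assms by (simp add: lp_norm_def lp_def powr_powr suminf_nonneg)

lemma sum_powr_le_lp_norm:
  assumes "y \<in> lp p" "0 < p"
  shows "(\<Sum>n<N. norm (y n) powr p) \<le> lp_norm p y powr p"
  unfolding lp_norm_powr[OF assms] using assms by (intro sum_le_suminf) (auto simp: lp_def)

lemma lp_norm_leI:
  assumes "0 < p" "0 \<le> c" and le: "\<And>N. (\<Sum>n<N. norm (y n) powr p) \<le> c powr p"
  shows "y \<in> lp p" "lp_norm p y \<le> c"
proof -
  have s: "summable (\<lambda>n. norm (y n) powr p)"
    by (rule summableI_nonneg_bounded[OF _ le]) simp
  then show "y \<in> lp p" by (simp add: lp_def)
  have "(\<Sum>n. norm (y n) powr p) \<le> c powr p"
    by (rule suminf_le_const[OF s le])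
  then have "lp_norm p y \<le> (c powr p) powr (1 / p)"
    unfolding lp_norm_def using assms(1) by (intro powr_mono2) (auto intro: suminf_nonneg s)
  then show "lp_norm p y \<le> c"
    using assms(1,2) by (simp add: powr_powr)
qed

lemma lp_norm_suminf_leI:
  assumes "0 < p" "0 \<le> c" "summable (\<lambda>n. norm (y n) powr p)" "(\<Sum>n. norm (y n) powr p) \<le> c powr p"
  shows "y \<in> lp p" "lp_norm p y \<le> c"
  using lp_norm_leI[OF assms(1,2), of y] sum_le_suminf[OF assms(3), of "{..<_}"] assms(4)
  by (auto intro: order_trans)

lemma lp_dominated:
  assumes "y \<in> lp p" "0 < p" "0 \<le> k" and le: "\<And>n. norm (x n) \<le> k * norm (y n)"
  shows "x \<in> lp p" "lp_norm p x \<le> k * lp_norm p y"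
proof -
  have "(\<Sum>n<N. norm (x n) powr p) \<le> (k * lp_norm p y) powr p" for N
  proof -
    have "(\<Sum>n<N. norm (x n) powr p) \<le> (\<Sum>n<N. (k * norm (y n)) powr p)"
      using assms by (intro sum_mono powr_mono2) auto
    also have "\<dots> = k powr p * (\<Sum>n<N. norm (y n) powr p)"
      by (simp add: powr_mult sum_distrib_left)
    also have "\<dots> \<le> k powr p * lp_norm p y powr p"
      by (intro mult_left_mono sum_powr_le_lp_norm assms) simp
    finally show ?thesis by (simp add: powr_mult)
  qed
  from lp_norm_leI[OF assms(2) _ this] assms(3)
  show "x \<in> lp p" "lp_norm p x \<le> k * lp_norm p y" by auto
qed

lemma norm_le_lp_norm:
  assumes "y \<in> lp p" "0 < p"
  shows "norm (y n) \<le> lp_norm p y"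
proof -
  have "norm (y n) powr p \<le> (\<Sum>n<Suc n. norm (y n) powr p)"
    by (rule member_le_sum) auto
  also have "\<dots> \<le> lp_norm p y powr p"
    by (rule sum_powr_le_lp_norm[OF assms])
  finally show ?thesis
    using assms(2) by (metis lp_norm_nonneg not_le powr_less_mono2)
qed

section \<open>Minkowski's inequality\<close>

lemma powr_convex_nonneg:
  fixes x y t p :: real
  assumes "1 \<le> p" "0 \<le> x" "0 \<le> y" "0 \<le> t" "t \<le> 1"
  shows "(t * x + (1 - t) * y) powr p \<le> t * x powr p + (1 - t) * y powr p"
proof -
  \<comment> \<open>Settles the case where \<open>x\<close> or \<open>y\<close> is 0, in which the
    claim reduces to this bound for \<open>t\<close> or \<open>1 - t\<close>.\<close>
  have le: "s powr p \<le> s" if "0 \<le> s" "s \<le> 1" for s :: real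
    using powr_mono'[of 1 p s] that assms(1) by simp
  show ?thesis
  proof (cases "x = 0 \<or> y = 0")
    case True
    then show ?thesis
      using le[of t] le[of "1 - t"] assms by (auto simp: powr_mult intro!: mult_right_mono)
  next
    case False
    then show ?thesis
      using convex_onD[OF powr_convex[OF assms(1)], of "1 - t" x y] assms by simp
  qed
qed

text \<open>Minkowski's inequality by normalization: \<open>x + y\<close> is \<open>A + B\<close>
  times the convex combination of \<open>x / A\<close> and \<open>y / B\<close> with weights
  \<open>A / (A + B)\<close> and \<open>B / (A + B)\<close>, and convexity of the power is used in
  each coordinate.\<close>

lemma lp_add:
  fixes x y :: "nat \<Rightarrow> 'a::real_normed_vector"
  assumes p: "1 \<le> p" and "x \<in> lp p" "y \<in> lp p"
  shows "(\<lambda>n. x n + y n) \<in> lp p" "lp_norm p (\<lambda>n. x n + y n) \<le> lp_norm p x + lp_norm p y"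
proof -
  \<comment> \<open>Taking \<open>A\<close> and \<open>B\<close> strictly above the norms makes them
    positive divisors even when a sequence vanishes; an arbitrarily small excess then gives the
    sharp bound.\<close>
  have *: "(\<lambda>n. x n + y n) \<in> lp p \<and> lp_norm p (\<lambda>n. x n + y n) \<le> A + B"
    if A: "lp_norm p x < A" and B: "lp_norm p y < B" for A B
  proof -
    have pos: "0 < A" "0 < B"
      using A B lp_norm_nonneg[of p x] lp_norm_nonneg[of p y] by linarith+
    have part: "(\<Sum>n<N. (norm (z n) / D) powr p) \<le> 1"
      if "z \<in> lp p" "lp_norm p z < D" "0 < D" for z :: "nat \<Rightarrow> 'a" and D N
    proof -
      have "(\<Sum>n<N. norm (z n) powr p) \<le> lp_norm p z powr p"
        using sum_powr_le_lp_norm[OF that(1)] p by simp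
      also have "\<dots> \<le> D powr p"
        using that p by (intro powr_mono2) auto
      finally show ?thesis
        using that by (simp add: powr_divide sum_divide_distrib[symmetric])
    qed
    define t where "t = A / (A + B)"
    have t: "0 \<le> t" "t \<le> 1" "1 - t = B / (A + B)"
      using pos by (auto simp: t_def field_simps)
    have "(\<Sum>n<N. norm (x n + y n) powr p) \<le> (A + B) powr p" for N
    proof -
      have "norm (x n + y n) powr p
          \<le> (A + B) powr p * (t * (norm (x n) / A) powr p + (1 - t) * (norm (y n) / B) powr p)" for n
      proof -
        have "norm (x n + y n) \<le> (A + B) * (t * (norm (x n) / A) + (1 - t) * (norm (y n) / B))"
          using norm_triangle_ineq[of "x n" "y n"] pos unfolding t(3) unfolding t_def by (simp add: distrib_left)
        then have "norm (x n + y n) powr p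
            \<le> ((A + B) * (t * (norm (x n) / A) + (1 - t) * (norm (y n) / B))) powr p"
          using p by (intro powr_mono2) auto
        also have "\<dots> = (A + B) powr p * (t * (norm (x n) / A) + (1 - t) * (norm (y n) / B)) powr p"
          by (simp add: powr_mult)
        also have "\<dots> \<le> (A + B) powr p * (t * (norm (x n) / A) powr p + (1 - t) * (norm (y n) / B) powr p)"
          using pos t p by (intro mult_left_mono powr_convex_nonneg) auto
        finally show ?thesis .
      qed
      then have "(\<Sum>n<N. norm (x n + y n) powr p)
          \<le> (A + B) powr p * (t * (\<Sum>n<N. (norm (x n) / A) powr p) + (1 - t) * (\<Sum>n<N. (norm (y n) / B) powr p))"
        by (simp add: sum_distrib_left sum.distrib[symmetric] sum_mono)
      also have "\<dots> \<le> (A + B) powr p * (t * 1 + (1 - t) * 1)"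
        using t part assms A B pos by (intro mult_left_mono add_mono) auto
      finally show ?thesis by simp
    qed
    from lp_norm_leI[OF _ _ this] p pos show ?thesis by simp
  qed
  from *[of "lp_norm p x + 1" "lp_norm p y + 1"] show "(\<lambda>n. x n + y n) \<in> lp p" by simp
  show "lp_norm p (\<lambda>n. x n + y n) \<le> lp_norm p x + lp_norm p y"
  proof (rule field_le_epsilon)
    fix e :: real assume "e > 0"
    with *[of "lp_norm p x + e / 2" "lp_norm p y + e / 2"]
    show "lp_norm p (\<lambda>n. x n + y n) \<le> lp_norm p x + lp_norm p y + e" by simp
  qed
qed

lemma powr_inject_nonneg:
  fixes x y p :: real
  assumes "0 < p" "0 \<le> x" "0 \<le> y"
  shows "x powr p = y powr p \<longleftrightarrow> x = y"
  using assms powr_less_mono2[of p x y] powr_less_mono2[of p y x] by (cases x y rule: linorder_cases) auto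

lemma lp_scaleR:
  assumes "0 < p" "y \<in> lp p"
  shows "(\<lambda>n. t *\<^sub>R y n) \<in> lp p" "lp_norm p (\<lambda>n. t *\<^sub>R y n) = \<bar>t\<bar> * lp_norm p y"
proof -
  show *: "(\<lambda>n. t *\<^sub>R y n) \<in> lp p"
    using lp_dominated(1)[OF assms(2,1), of "\<bar>t\<bar>" "\<lambda>n. t *\<^sub>R y n"] by simp
  have "lp_norm p (\<lambda>n. t *\<^sub>R y n) powr p = (\<bar>t\<bar> * lp_norm p y) powr p"
    using assms * by (simp add: lp_norm_powr powr_mult suminf_mult lp_def)
  then show "lp_norm p (\<lambda>n. t *\<^sub>R y n) = \<bar>t\<bar> * lp_norm p y"
    using assms(1) by (simp add: powr_inject_nonneg)
qed

lemma lp_finite_support: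
  fixes y :: "nat \<Rightarrow> 'a::real_normed_vector"
  assumes "0 < p" and zero: "\<And>n. n \<ge> N \<Longrightarrow> y n = 0"
  shows "y \<in> lp p" "lp_norm p y = (\<Sum>n<N. norm (y n) powr p) powr (1 / p)"
proof -
  have "(\<lambda>n. norm (y n) powr p) sums (\<Sum>n<N. norm (y n) powr p)"
    by (rule sums_finite) (use zero in auto)
  then show "y \<in> lp p" "lp_norm p y = (\<Sum>n<N. norm (y n) powr p) powr (1 / p)"
    by (auto simp: lp_def lp_norm_def sums_iff)
qed

lemma lp_tail_tendsto_0:
  fixes y :: "nat \<Rightarrow> 'a::real_normed_vector"
  assumes "0 < p" "y \<in> lp p"
  shows "(\<lambda>N. lp_norm p (\<lambda>n. if n < N then 0 else y n)) \<longlonglongrightarrow> 0"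
proof -
  have s: "summable (\<lambda>n. norm (y n) powr p)" using assms by (simp add: lp_def)
  have eq: "(\<Sum>n. norm (if n < N then 0 else y n) powr p)
      = (\<Sum>n. norm (y n) powr p) - (\<Sum>n<N. norm (y n) powr p)" for N
  proof -
    have "(\<lambda>n. norm (y n) powr p - (if n \<in> {..<N} then norm (y n) powr p else 0))
        sums ((\<Sum>n. norm (y n) powr p) - (\<Sum>n<N. norm (y n) powr p))"
      by (intro sums_diff summable_sums s sums_If_finite_set) auto
    moreover have "(\<lambda>n. norm (y n) powr p - (if n \<in> {..<N} then norm (y n) powr p else 0))
        = (\<lambda>n. norm (if n < N then 0 else y n) powr p)"
      by auto
    ultimately show ?thesis by (simp add: sums_iff)
  qed
  have "(\<lambda>N. (\<Sum>n. norm (y n) powr p) - (\<Sum>n<N. norm (y n) powr p))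
      \<longlonglongrightarrow> (\<Sum>n. norm (y n) powr p) - (\<Sum>n. norm (y n) powr p)"
    by (intro tendsto_intros summable_LIMSEQ s)
  then have "(\<lambda>N. ((\<Sum>n. norm (y n) powr p) - (\<Sum>n<N. norm (y n) powr p)) powr (1 / p))
      \<longlonglongrightarrow> 0 powr (1 / p)"
    using assms(1) by (intro tendsto_powr2) (auto intro!: always_eventually sum_le_suminf s)
  then show ?thesis by (simp add: lp_norm_def eq)
qed

section \<open>Young's and Hoelder's inequalities and the conjugate ball\<close>

lemma Young_inequality:
  fixes a b p q :: real
  assumes "1 < p" "q = p / (p - 1)" "0 \<le> a" "0 \<le> b"
  shows "a * b \<le> a powr q / q + b powr p / p"
proof (cases "a = 0 \<or> b = 0")
  case False
  then have ab: "a > 0" "b > 0" using assms by auto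
  \<comment> \<open>Convexity of \<open>exp\<close> at the points \<open>q * ln a\<close> and
    \<open>p * ln b\<close> with weights \<open>1 / q\<close> and \<open>1 / p\<close>.\<close>
  have "exp ((1 - 1 / p) *\<^sub>R (q * ln a) + (1 / p) *\<^sub>R (p * ln b))
      \<le> (1 - 1 / p) * exp (q * ln a) + (1 / p) * exp (p * ln b)"
    using assms by (intro convex_onD[OF exp_convex]) auto
  moreover have q: "1 - 1 / p = 1 / q" "q \<noteq> 0"
    using assms(1) unfolding assms(2) by (auto simp: field_simps)
  moreover have "(1 - 1 / p) *\<^sub>R (q * ln a) + (1 / p) *\<^sub>R (p * ln b) = ln a + ln b"
    using assms(1) q(2) unfolding q(1) by simp
  ultimately show ?thesis
    using ab by (simp add: exp_add powr_def)
qed (use assms in auto)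

text \<open>After normalizing \<open>v\<close>, Young's inequality is summed over a finite section,
  with total at most \<open>1 / q + 1 / p = 1\<close>. For \<open>p = 1\<close> the coefficients are
  bounded by 1 and the comparison is direct.\<close>

lemma Hoelder_conjugate_ball:
  fixes v :: "nat \<Rightarrow> 'a::real_normed_vector"
  assumes p: "1 \<le> p" and \<alpha>: "\<alpha> \<in> conjugate_ball p" and v: "v \<in> lp p"
  shows "summable (\<lambda>n. cmod (\<alpha> n) * norm (v n))"
    and "(\<Sum>n. cmod (\<alpha> n) * norm (v n)) \<le> lp_norm p v"
proof -
  have *: "(\<Sum>n<N. cmod (\<alpha> n) * norm (v n)) \<le> lp_norm p v" for N
  proof (cases "p = 1")
    case True
    then have "cmod (\<alpha> n) \<le> 1" for n using \<alpha> by (simp add: conjugate_ball_def)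
    then have "(\<Sum>n<N. cmod (\<alpha> n) * norm (v n)) \<le> (\<Sum>n<N. norm (v n) powr p)"
      using True by (intro sum_mono) (simp add: mult_left_le_one_le)
    also have "\<dots> \<le> lp_norm p v"
      using sum_powr_le_lp_norm[OF v, of N] True by simp
    finally show ?thesis .
  next
    case False
    then have p1: "1 < p" using p by simp
    define q where "q = p / (p - 1)"
    have q: "0 < q" "1 / q + 1 / p = 1" using p1 by (auto simp: q_def field_simps)
    have \<alpha>q: "\<alpha> \<in> lp q" "lp_norm q \<alpha> \<le> 1"
      using \<alpha> False by (auto simp: conjugate_ball_def q_def Let_def)
    show ?thesis
    proof (rule field_le_epsilon)
      fix e :: real assume "e > 0"
      \<comment> \<open>The slack \<open>e\<close> keeps the divisor positive even if
        \<open>v\<close> is zero.\<close>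
      define B where "B = lp_norm p v + e"
      have B: "B > 0" "lp_norm p v \<le> B"
        using \<open>e > 0\<close> lp_norm_nonneg[of p v] by (auto simp: B_def intro: add_nonneg_pos)
      have v1: "(\<Sum>n<N. (norm (v n) / B) powr p) \<le> 1"
      proof -
        have "(\<Sum>n<N. norm (v n) powr p) \<le> lp_norm p v powr p"
          using sum_powr_le_lp_norm[OF v] p by simp
        also have "\<dots> \<le> B powr p"
          using B p by (intro powr_mono2) auto
        finally show ?thesis
          using B by (simp add: powr_divide sum_divide_distrib[symmetric])
      qed
      have \<alpha>1: "(\<Sum>n<N. cmod (\<alpha> n) powr q) \<le> 1"
        using sum_powr_le_lp_norm[OF \<alpha>q(1) q(1), of N] powr_mono2[OF _ _ \<alpha>q(2), of q] q(1) by simp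
      have "(\<Sum>n<N. cmod (\<alpha> n) * (norm (v n) / B))
          \<le> (\<Sum>n<N. cmod (\<alpha> n) powr q / q + (norm (v n) / B) powr p / p)"
        using B by (intro sum_mono Young_inequality p1 q_def) auto
      also have "\<dots> = (\<Sum>n<N. cmod (\<alpha> n) powr q) / q + (\<Sum>n<N. (norm (v n) / B) powr p) / p"
        by (simp add: sum.distrib sum_divide_distrib)
      also have "\<dots> \<le> 1 / q + 1 / p"
        using v1 \<alpha>1 q p by (intro add_mono divide_right_mono) auto
      finally have "(\<Sum>n<N. cmod (\<alpha> n) * norm (v n)) / B \<le> 1"
        using q by (simp add: sum_divide_distrib)
      then show "(\<Sum>n<N. cmod (\<alpha> n) * norm (v n)) \<le> lp_norm p v + e"
        using B by (simp add: B_def)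
    qed
  qed
  show s: "summable (\<lambda>n. cmod (\<alpha> n) * norm (v n))"
    by (rule summableI_nonneg_bounded[OF _ *]) simp
  show "(\<Sum>n. cmod (\<alpha> n) * norm (v n)) \<le> lp_norm p v"
    by (rule suminf_le_const[OF s *])
qed

lemma summable_norm_scaleC_conjugate_ball:
  fixes v :: "nat \<Rightarrow> 'a::complex_normed_vector"
  assumes "1 \<le> p" "\<alpha> \<in> conjugate_ball p" "v \<in> lp p"
  shows "summable (\<lambda>n. norm (\<alpha> n *\<^sub>C v n))"
  using Hoelder_conjugate_ball(1)[OF assms] by (simp add: norm_scaleC)

lemma norm_suminf_conjugate_ball:
  fixes v :: "nat \<Rightarrow> 'a::complex_banach"
  assumes "1 \<le> p" "\<alpha> \<in> conjugate_ball p" "v \<in> lp p"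
  shows "norm (\<Sum>n. \<alpha> n *\<^sub>C v n) \<le> lp_norm p v"
  using summable_norm[OF summable_norm_scaleC_conjugate_ball[OF assms]]
    Hoelder_conjugate_ball(2)[OF assms] by (simp add: norm_scaleC)

text \<open>A converse of Hoelder's inequality on finite sections. Testing with
  \<open>v n = cmod (\<alpha> n) powr (q - 1)\<close> gives \<open>S \<le> S powr (1 / p)\<close>
  for every partial sum \<open>S\<close> of \<open>cmod (\<alpha> n) powr q\<close>, which excludes
  \<open>S > 1\<close>. For \<open>p = 1\<close> unit vectors are tested.\<close>

lemma conjugate_ballI:
  assumes p: "1 \<le> p"
    and le: "\<And>N v. (\<And>n. 0 \<le> v n) \<Longrightarrow>
      (\<Sum>n<N. cmod (\<alpha> n) * v n) \<le> (\<Sum>n<N. v n powr p) powr (1 / p)"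
  shows "\<alpha> \<in> conjugate_ball p"
proof (cases "p = 1")
  case True
  have "cmod (\<alpha> n) \<le> 1" for n
    using le[of "\<lambda>k. if k = n then 1 else 0" "Suc n"] True by (simp add: sum.delta' if_distrib cong: if_cong)
  then show ?thesis using True by (simp add: conjugate_ball_def)
next
  case False
  then have p1: "1 < p" using p by simp
  define q where "q = p / (p - 1)"
  have q: "0 < q" "(q - 1) * p = q" using p1 by (auto simp: q_def field_simps)
  have "(\<Sum>n<N. cmod (\<alpha> n) powr q) \<le> 1 powr q" for N
  proof (rule ccontr)
    define S where "S = (\<Sum>n<N. cmod (\<alpha> n) powr q)"
    assume "\<not> (\<Sum>n<N. cmod (\<alpha> n) powr q) \<le> 1 powr q"
    then have S: "S > 1" by (simp add: S_def)
    have "S = (\<Sum>n<N. cmod (\<alpha> n) * cmod (\<alpha> n) powr (q - 1))"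
      unfolding S_def by (intro sum.cong refl) (auto simp: powr_diff)
    also have "\<dots> \<le> S powr (1 / p)"
      using le[of "\<lambda>n. cmod (\<alpha> n) powr (q - 1)" N] by (simp add: powr_powr q S_def)
    also have "\<dots> < S powr 1"
      using S p1 by (intro powr_less_mono) auto
    finally show False using S by simp
  qed
  from lp_norm_leI[OF q(1) _ this] False show ?thesis
    by (simp add: conjugate_ball_def q_def Let_def)
qed

lemma unit_sequence_in_conjugate_ball:
  assumes "1 \<le> p"
  shows "(\<lambda>n. if n = k then 1 else 0) \<in> conjugate_ball p"
proof (cases "p = 1")
  case False
  then have "0 < p / (p - 1)" using assms by simp
  from lp_finite_support[OF this, of "Suc k" "\<lambda>n. if n = k then 1 else 0 :: complex"] False
  show ?thesis by (simp add: conjugate_ball_def Let_def if_distrib cong: if_cong)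
qed (simp add: conjugate_ball_def)

lemma conjugate_ball_cmod_le_1:
  assumes "1 \<le> p" "\<alpha> \<in> conjugate_ball p"
  shows "cmod (\<alpha> k) \<le> 1"
proof (cases "p = 1")
  case False
  then have "0 < p / (p - 1)" using assms(1) by simp
  with norm_le_lp_norm[of \<alpha> "p / (p - 1)" k] assms(2) False show ?thesis
    by (simp add: conjugate_ball_def Let_def)
qed (use assms in \<open>simp add: conjugate_ball_def\<close>)

text \<open>Fubini for absolutely convergent double series, with \<open>prod_decode\<close>
  enumerating the index pairs; unordered sums mediate between the enumeration and the iterated
  sum.\<close>

lemma suminf_double:
  fixes f :: "nat \<Rightarrow> nat \<Rightarrow> 'a::banach"
  assumes row: "\<And>i. summable (\<lambda>n. norm (f i n))" and "summable (\<lambda>i. \<Sum>n. norm (f i n))"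
  shows "summable (\<lambda>k. norm (case_prod f (prod_decode k)))"
    and "(\<lambda>i. \<Sum>n. f i n) sums (\<Sum>k. case_prod f (prod_decode k))"
proof -
  have infsum_nat: "infsum g UNIV = suminf g" if "summable (\<lambda>n. norm (g n))" for g :: "nat \<Rightarrow> 'b::banach"
    using norm_summable_imp_has_sum[OF that summable_sums[OF summable_norm_cancel[OF that]]]
    by (rule infsumI)
  have r: "infsum (\<lambda>n. norm (f i n)) UNIV = (\<Sum>n. norm (f i n))" for i
    using row by (intro infsum_nat) simp
  have "(\<lambda>n. norm (f i n)) summable_on UNIV" for i
    using row by (simp add: summable_on_UNIV_nonneg_real_iff)
  moreover have "(\<lambda>i. infsum (\<lambda>n. norm (f i n)) UNIV) summable_on UNIV"
    using assms(2) row by (simp add: r summable_on_UNIV_nonneg_real_iff suminf_nonneg)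
  ultimately have abs: "(\<lambda>z. norm (case_prod f z)) summable_on UNIV"
    using Infinite_Sum.abs_summable_on_Sigma_iff[of "case_prod f" UNIV "\<lambda>_. UNIV"]
    by (simp add: infsum_nonneg)
  then have "(\<lambda>k. norm (case_prod f (prod_decode k))) summable_on UNIV"
    using summable_on_reindex[OF inj_prod_decode[of UNIV], of "\<lambda>z. norm (case_prod f z)"]
    by (simp only: surj_prod_decode comp_def)
  then show s: "summable (\<lambda>k. norm (case_prod f (prod_decode k)))"
    by (rule summable_on_imp_summable)
  have hs: "(case_prod f has_sum infsum (case_prod f) UNIV) UNIV"
    by (rule has_sum_infsum[OF abs_summable_summable[OF abs]])
  then have "((\<lambda>k. case_prod f (prod_decode k)) has_sum infsum (case_prod f) UNIV) UNIV"
    using has_sum_reindex[OF inj_prod_decode[of UNIV], of "case_prod f"]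
    by (simp only: surj_prod_decode comp_def)
  then have "(\<Sum>k. case_prod f (prod_decode k)) = infsum (case_prod f) UNIV"
    by (rule sums_unique[OF has_sum_imp_sums, symmetric])
  with hs have "(case_prod f has_sum (\<Sum>k. case_prod f (prod_decode k))) (SIGMA i:UNIV. UNIV)"
    by simp
  moreover have "((\<lambda>n. case_prod f (i, n)) has_sum (\<Sum>n. f i n)) UNIV" for i
    using norm_summable_imp_has_sum[OF row summable_sums[OF summable_norm_cancel[OF row]]] by simp
  ultimately have "((\<lambda>i. \<Sum>n. f i n) has_sum (\<Sum>k. case_prod f (prod_decode k))) UNIV"
    by (rule has_sum_SigmaD)
  then show "(\<lambda>i. \<Sum>n. f i n) sums (\<Sum>k. case_prod f (prod_decode k))"
    by (rule has_sum_imp_sums)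
qed

section \<open>Functionals dominated by sequences\<close>

lemma norm_cblinfun_apply: "norm (cblinfun_apply f x) \<le> norm f * norm x"
  unfolding norm_cblinfun.rep_eq by (rule onorm[OF bounded_linear_cblinfun])

lemma norm_cblinfun_leI:
  "0 \<le> M \<Longrightarrow> (\<And>x. norm (cblinfun_apply f x) \<le> M * norm x) \<Longrightarrow> norm f \<le> M"
  unfolding norm_cblinfun.rep_eq by (rule onorm_bound)

lemma clinear_add: "clinear f \<Longrightarrow> f (x + y) = f x + f y"
  and clinear_scaleC: "clinear f \<Longrightarrow> f (c *\<^sub>C x) = c *\<^sub>C f x"
  by (auto simp: clinear_def)

lemmas cblinfun_apply_add = clinear_add[OF clinear_cblinfun]
  and cblinfun_apply_scaleC = clinear_scaleC[OF clinear_cblinfun]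

lemma scaleC_eq_scaleR: "c *\<^sub>C x = Re c *\<^sub>R x + Im c *\<^sub>R (\<i> *\<^sub>C x)" for x :: "'a::complex_normed_vector"
proof -
  have "c *\<^sub>C x = (complex_of_real (Re c) + complex_of_real (Im c) * \<i>) *\<^sub>C x"
    by (simp add: complex_eq[symmetric] mult.commute)
  then show ?thesis
    by (simp only: scaleC_add_left scaleC_scaleC[symmetric] scaleC_of_real)
qed

text \<open>The complex functional is \<open>g x = f x - \<i> * f (\<i> *\<^sub>C x)\<close>. Its
  modulus at \<open>x\<close> is the value of \<open>f\<close> at a rotated vector of the same norm,
  so the bound carries over.\<close>

lemma complexify_real_functional:
  fixes f :: "'a::complex_normed_vector \<Rightarrow> real"
  assumes f: "linear f" and M: "0 \<le> M" and le: "\<And>x. f x \<le> M * norm x"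
  obtains y' :: "'a cdual" where "\<And>x. Re (cblinfun_apply y' x) = f x" "norm y' \<le> M"
proof -
  define g where "g x = Complex (f x) (- f (\<i> *\<^sub>C x))" for x
  have f_scaleC: "f (c *\<^sub>C x) = Re c * f x + Im c * f (\<i> *\<^sub>C x)" for c x
    by (subst scaleC_eq_scaleR) (simp add: linear_add[OF f] linear_scale[OF f])
  have cl: "clinear g"
    unfolding clinear_def
  proof (intro conjI allI)
    show "g (x + y) = g x + g y" for x y
      by (simp add: g_def scaleC_add_right linear_add[OF f] complex_eq_iff)
    show "g (c *\<^sub>C x) = c *\<^sub>C g x" for c x
      using f_scaleC[of c x] f_scaleC[of "\<i> * c" x]
      by (simp add: g_def scaleC_complex_def scaleC_scaleC complex_eq_iff)
  qed
  have bound: "norm (g x) \<le> M * norm x" for x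
  proof (cases "g x = 0")
    case False
    define u where "u = cnj (sgn (g x))"
    have "u * g x = complex_of_real (cmod (g x))"
      using complex_norm_square[of "g x"] False
      by (simp add: u_def sgn_eq mult.commute field_simps power2_eq_square)
    then have "cmod (g x) = Re (g (u *\<^sub>C x))"
      using cl by (simp add: clinear_def scaleC_complex_def)
    also have "\<dots> = f (u *\<^sub>C x)" by (simp add: g_def)
    also have "\<dots> \<le> M * norm x"
      using le[of "u *\<^sub>C x"] False by (simp add: u_def norm_scaleC norm_sgn)
    finally show ?thesis .
  qed (use M in simp)
  have "bounded_linear g"
    using bound by (intro bounded_linear.intro bounded_linear_axioms.intro clinear_imp_linear cl)
      (auto simp: mult.commute)
  with cl have eq: "cblinfun_apply (CBlinfun g) = g"
    by (simp add: CBlinfun_inverse)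
  show thesis
    by (rule that[of "CBlinfun g"]) (auto simp: eq g_def[THEN arg_cong[of _ _ Re]] bound intro!: norm_cblinfun_leI M)
qed

lemma norming_functional:
  fixes x :: "'a::complex_normed_vector"
  obtains y' :: "'a cdual" where "norm y' \<le> 1" "Re (cblinfun_apply y' x) = norm x"
proof -
  have "sublinear (norm :: 'a \<Rightarrow> real)"
    by (auto simp: sublinear_def norm_triangle_ineq)
  then obtain f :: "'a \<Rightarrow> real" where f: "linear f" "\<And>y. f y \<le> norm y" "f x = norm x"
    using Hahn_Banach_support[of norm x] by blast
  obtain y' :: "'a cdual" where "\<And>y. Re (cblinfun_apply y' y) = f y" "norm y' \<le> 1"
    using complexify_real_functional[OF f(1), of 1] f(2) by auto
  with f(3) that show thesis by metis
qed

text \<open>Sequences and families of vectors form a real vector space, to which the Hahn-Banach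
  theorem is applied below.\<close>

instantiation "fun" :: (type, real_vector) real_vector
begin

definition scaleR_fun :: "real \<Rightarrow> ('a \<Rightarrow> 'b) \<Rightarrow> 'a \<Rightarrow> 'b"
  where "scaleR_fun r f = (\<lambda>x. r *\<^sub>R f x)"

instance
  by standard (auto simp: scaleR_fun_def fun_eq_iff algebra_simps)

end

lemma scaleR_fun_apply [simp]: "(r *\<^sub>R f) x = r *\<^sub>R f x"
  by (simp add: scaleR_fun_def)

lemma subspace_lp:
  assumes "1 \<le> p"
  shows "subspace (lp p :: (nat \<Rightarrow> 'a::real_normed_vector) set)"
proof (rule subspaceI)
  show "0 \<in> (lp p :: (nat \<Rightarrow> 'a) set)" by (simp add: lp_def)
  show "x + y \<in> lp p" if "x \<in> lp p" "y \<in> lp p" for x y :: "nat \<Rightarrow> 'a"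
    using lp_add(1)[OF assms that] by (simp add: plus_fun_def)
  show "c *\<^sub>R x \<in> lp p" if "x \<in> lp p" for c and x :: "nat \<Rightarrow> 'a"
    using lp_scaleR(1)[OF _ that, of c] assms by (simp add: scaleR_fun_def)
qed

lemma sublinear_lp_norm_projection:
  assumes p: "1 \<le> p" and \<pi>: "linear \<pi>" "range \<pi> \<subseteq> lp p"
  shows "sublinear (\<lambda>v. lp_norm p (\<pi> v))"
  unfolding sublinear_def
proof (intro conjI allI impI)
  have lp: "\<pi> v \<in> lp p" for v using \<pi>(2) by auto
  show "lp_norm p (\<pi> (u + v)) \<le> lp_norm p (\<pi> u) + lp_norm p (\<pi> v)" for u v
    using lp_add(2)[OF p lp lp, of u v] by (simp add: linear_add[OF \<pi>(1)] plus_fun_def)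
  show "lp_norm p (\<pi> (t *\<^sub>R v)) = t * lp_norm p (\<pi> v)" if "0 \<le> t" for t v
    using lp_scaleR(2)[OF _ lp, of t v] p that by (simp add: linear_scale[OF \<pi>(1)] scaleR_fun_def)
qed

text \<open>The Hahn-Banach extension of \<open>(\<Phi> n x)\<^sub>n \<mapsto> g x\<close> to \<open>\<ell>\<^sub>p\<close>, represented by a sequence.
  The linear projection \<open>\<pi>\<close> only serves to make the \<open>\<ell>\<^sub>p\<close>-norm finite on all sequences.\<close>

lemma dominated_functional_representation:
  fixes g :: "'a::complex_normed_vector \<Rightarrow> complex" and \<Phi> :: "nat \<Rightarrow> 'a \<Rightarrow> complex"
  assumes p: "1 \<le> p" and g: "clinear g" and \<Phi>: "\<And>n. clinear (\<Phi> n)"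
    and lp: "\<And>x. (\<lambda>n. \<Phi> n x) \<in> lp p"
    and le: "\<And>x. cmod (g x) \<le> lp_norm p (\<lambda>n. \<Phi> n x)"
  obtains \<alpha> where "\<alpha> \<in> conjugate_ball p" "\<And>x. g x = (\<Sum>n. \<alpha> n * \<Phi> n x)"
proof -
  have p0: "0 < p" using p by simp
  obtain \<pi> :: "(nat \<Rightarrow> complex) \<Rightarrow> nat \<Rightarrow> complex"
    where \<pi>: "linear \<pi>" "range \<pi> \<subseteq> lp p" and \<pi>_id: "\<And>v. v \<in> lp p \<Longrightarrow> \<pi> v = v"
    using linear_exists_left_inverse_on[OF linear_id subspace_lp[OF p]] by force
  define q where "q v = lp_norm p (\<pi> v)" for v
  have q_lp: "q v = lp_norm p v" if "v \<in> lp p" for v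
    using \<pi>_id[OF that] by (simp add: q_def)
  have q: "sublinear q"
    unfolding q_def by (rule sublinear_lp_norm_projection[OF p \<pi>])
  have lin: "linear g" "linear (\<Phi> n)" for n
    using g \<Phi> by (auto intro: clinear_imp_linear)
  \<comment> \<open>The range of \<open>?h\<close> plays the graph of \<open>Re (g x)\<close> over
    the sequences \<open>\<lambda>n. \<Phi> n x\<close>. It is a subspace, so the upper bound on
    this cone holds at both \<open>x\<close> and \<open>- x\<close> and becomes an equality.\<close>
  let ?h = "\<lambda>x. ((\<lambda>n. \<Phi> n x), Re (g x))"
  have "linear ?h"
    by (intro linearI) (auto simp: linear_add[OF lin(1)] linear_add[OF lin(2)] linear_scale[OF lin(1)]
      linear_scale[OF lin(2)] fun_eq_iff)
  then have C: "convex_cone (range ?h)"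
    using convex_cone_linear_image[of UNIV ?h] by (simp add: convex_cone_iff)
  have nonneg: "0 \<le> q (- w) + r" if "(w, r) \<in> range ?h" for w r
  proof -
    from that obtain x where x: "w = (\<lambda>n. \<Phi> n x)" "r = Re (g x)" by auto
    have "- w = (-1) *\<^sub>R w" by simp
    then have "- w \<in> lp p" "lp_norm p (- w) = lp_norm p w"
      using lp_scaleR[OF p0 lp, of "-1" x] by (auto simp: x scaleR_fun_def)
    then show ?thesis
      using le[of x] abs_Re_le_cmod[of "g x"] by (simp add: q_lp x)
  qed
  obtain f where f: "linear f" "\<And>v. f v \<le> q v" "\<And>w r. (w, r) \<in> range ?h \<Longrightarrow> f w \<le> r"
    using Hahn_Banach_convex_cone[of q "range ?h"] q C nonneg by blast
  have f_le: "f v \<le> lp_norm p v" if "v \<in> lp p" for v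
    using f(2)[of v] q_lp[OF that] by simp
  have f_\<Phi>: "f (\<lambda>n. \<Phi> n x) = Re (g x)" for x
  proof (rule antisym)
    show "f (\<lambda>n. \<Phi> n x) \<le> Re (g x)" using f(3) by blast
    have "f (\<lambda>n. \<Phi> n (- x)) \<le> Re (g (- x))" using f(3) by blast
    moreover have "(\<lambda>n. \<Phi> n (- x)) = - (\<lambda>n. \<Phi> n x)"
      by (simp add: linear_neg[OF lin(2)] fun_eq_iff)
    ultimately show "Re (g x) \<le> f (\<lambda>n. \<Phi> n x)"
      by (simp add: linear_neg[OF lin(1)] linear_neg[OF f(1)])
  qed
  define e :: "nat \<Rightarrow> complex \<Rightarrow> nat \<Rightarrow> complex" where "e n c = (\<lambda>k. if k = n then c else 0)" for n c
  \<comment> \<open>On coordinate \<open>n\<close> the map \<open>c \<mapsto> f (e n c)\<close> is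
    real linear, and this is the number with \<open>f (e n c) = Re (\<alpha> n * c)\<close>.\<close>
  define \<alpha> where "\<alpha> n = Complex (f (e n 1)) (- f (e n \<i>))" for n
  define trunc :: "nat \<Rightarrow> (nat \<Rightarrow> complex) \<Rightarrow> nat \<Rightarrow> complex" where "trunc N v = (\<lambda>k. if k < N then v k else 0)" for N v
  have f_trunc: "f (trunc N v) = Re (\<Sum>k<N. \<alpha> k * v k)" for N v
  proof (induction N)
    case 0
    have "trunc 0 v = 0" by (simp add: trunc_def fun_eq_iff)
    then show ?case by (simp only: linear_0[OF f(1)]) simp
  next
    case (Suc N)
    have "e N (v N) = Re (v N) *\<^sub>R e N 1 + Im (v N) *\<^sub>R e N \<i>"
      by (auto simp: e_def fun_eq_iff complex_eq_iff)
    then have "f (e N (v N)) = Re (\<alpha> N * v N)"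
      by (simp add: linear_add[OF f(1)] linear_scale[OF f(1)] \<alpha>_def)
    moreover have "trunc (Suc N) v = trunc N v + e N (v N)"
      by (auto simp: trunc_def e_def fun_eq_iff less_Suc_eq)
    ultimately show ?case
      using Suc by (simp only: linear_add[OF f(1)] sum.lessThan_Suc plus_complex.sel)
  qed
  have \<alpha>: "\<alpha> \<in> conjugate_ball p"
  proof (rule conjugate_ballI[OF p])
    fix N and v :: "nat \<Rightarrow> real" assume v: "\<And>n. 0 \<le> v n"
    \<comment> \<open>The phase of \<open>w n\<close> is opposite to that of
      \<open>\<alpha> n\<close>, so the products \<open>\<alpha> n * w n\<close> add up without
      cancellation.\<close>
    define w where "w n = cnj (sgn (\<alpha> n)) * v n" for n
    have "\<alpha> n * w n = complex_of_real (cmod (\<alpha> n) * v n)" for n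
    proof (cases "\<alpha> n = 0")
      case False
      then have "\<alpha> n * cnj (sgn (\<alpha> n)) = complex_of_real (cmod (\<alpha> n))"
        using complex_norm_square[of "\<alpha> n"]
        by (simp add: sgn_eq field_simps power2_eq_square)
      then show ?thesis by (simp add: w_def mult.assoc[symmetric])
    qed simp
    then have "(\<Sum>n<N. cmod (\<alpha> n) * v n) = f (trunc N w)"
      by (simp add: f_trunc)
    also have "\<dots> \<le> lp_norm p (trunc N w)"
      by (intro f_le lp_finite_support[OF p0, of N]) (simp add: trunc_def)
    also have "\<dots> = (\<Sum>n<N. norm (trunc N w n) powr p) powr (1 / p)"
      by (intro lp_finite_support[OF p0, of N]) (simp add: trunc_def)
    also have "\<dots> \<le> (\<Sum>n<N. v n powr p) powr (1 / p)"
      using p v by (intro powr_mono2 sum_mono) (auto simp: trunc_def w_def norm_mult norm_sgn intro: sum_nonneg)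
    finally show "(\<Sum>n<N. cmod (\<alpha> n) * v n) \<le> (\<Sum>n<N. v n powr p) powr (1 / p)" .
  qed
  have sums: "(\<lambda>n. \<alpha> n * \<Phi> n x) sums (\<Sum>n. \<alpha> n * \<Phi> n x)" for x
    using Hoelder_conjugate_ball(1)[OF p \<alpha> lp[of x]]
    by (intro summable_sums summable_norm_cancel[of "\<lambda>n. \<alpha> n * \<Phi> n x"]) (simp add: norm_mult)
  \<comment> \<open>By \<open>f_le\<close>, \<open>f\<close> is continuous for the
    \<open>\<ell>\<^sub>p\<close> norm, in which truncations converge; so the formula passes from
    truncations to the full sequence.\<close>
  have Re_eq: "Re (g x) = Re (\<Sum>n. \<alpha> n * \<Phi> n x)" for x
  proof -
    define v where "v = (\<lambda>n. \<Phi> n x)"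
    have v: "v \<in> lp p" using lp by (simp add: v_def)
    have "\<bar>f v - f (trunc N v)\<bar> \<le> lp_norm p (\<lambda>n. if n < N then 0 else v n)" for N
    proof -
      define t where "t = (\<lambda>n. if n < N then 0 else v n)"
      have t: "t \<in> lp p"
        by (rule lp_dominated(1)[OF v p0, of 1]) (auto simp: t_def)
      have "v = trunc N v + t" by (auto simp: trunc_def t_def fun_eq_iff)
      then have "f v - f (trunc N v) = f t"
        using linear_add[OF f(1), of "trunc N v" t] by simp
      moreover have "- f t \<le> lp_norm p t"
        using f_le[OF lp_scaleR(1)[OF p0 t, of "-1"]] lp_scaleR(2)[OF p0 t, of "-1"]
          linear_scale[OF f(1), of "-1" t] by (simp add: scaleR_fun_def)
      ultimately show ?thesis using f_le[OF t] by (simp add: t_def)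
    qed
    then have "(\<lambda>N. f v - f (trunc N v)) \<longlonglongrightarrow> 0"
      by (intro Lim_null_comparison[OF _ lp_tail_tendsto_0[OF p0 v]]) auto
    then have "(\<lambda>N. f (trunc N v)) \<longlonglongrightarrow> f v"
      using tendsto_diff[OF tendsto_const[of "f v"], of "\<lambda>N. f v - f (trunc N v)" 0] by simp
    moreover have "(\<lambda>N. f (trunc N v)) \<longlonglongrightarrow> Re (\<Sum>n. \<alpha> n * \<Phi> n x)"
      using sums[of x] unfolding f_trunc v_def sums_def by (rule tendsto_Re)
    ultimately have "f v = Re (\<Sum>n. \<alpha> n * \<Phi> n x)"
      by (rule LIMSEQ_unique)
    then show ?thesis using f_\<Phi>[of x] by (simp add: v_def)
  qed
  \<comment> \<open>The imaginary part at \<open>x\<close> is minus the real part at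
    \<open>\<i> *\<^sub>C x\<close>.\<close>
  have "g x = (\<Sum>n. \<alpha> n * \<Phi> n x)" for x
  proof -
    have "(\<Sum>n. \<alpha> n * \<Phi> n (\<i> *\<^sub>C x)) = \<i> * (\<Sum>n. \<alpha> n * \<Phi> n x)"
      using sums_mult[OF sums[of x], of \<i>]
      by (simp add: clinear_scaleC[OF \<Phi>] scaleC_complex_def sums_iff mult_ac)
    then show ?thesis
      using Re_eq[of x] Re_eq[of "\<i> *\<^sub>C x"]
      by (simp add: clinear_scaleC[OF g] scaleC_complex_def complex_eq_iff)
  qed
  with \<alpha> that show thesis by blast
qed

lemma cblinfun_apply_sum: "cblinfun_apply (sum f S) x = (\<Sum>i\<in>S. cblinfun_apply (f i) x)"
  by (induction S rule: infinite_finite_induct) (auto simp: zero_cblinfun.rep_eq plus_cblinfun.rep_eq)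

text \<open>Multiplying \<open>x\<close> by a unimodular scalar makes the value real and
  nonnegative, so real parts on the unit ball control the norm.\<close>

lemma norm_cdual_le_ReI:
  fixes \<phi> :: "'a::complex_normed_vector cdual"
  assumes le: "\<And>x. norm x \<le> 1 \<Longrightarrow> Re (cblinfun_apply \<phi> x) \<le> M"
  shows "norm \<phi> \<le> M"
proof (rule norm_cblinfun_leI)
  have 0: "cblinfun_apply \<phi> 0 = 0"
    by (rule linear_0[OF clinear_imp_linear[OF clinear_cblinfun]])
  show "0 \<le> M" using le[of 0] 0 by simp
  show "norm (cblinfun_apply \<phi> x) \<le> M * norm x" for x
  proof (cases "cblinfun_apply \<phi> x = 0")
    case True
    then show ?thesis using \<open>0 \<le> M\<close> by simp
  next
    case False
    define w where "w = cblinfun_apply \<phi> x"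
    have x: "norm x > 0" using False 0 by auto
    have w: "w \<noteq> 0" using False by (simp add: w_def)
    have "cnj (sgn w) * w = complex_of_real (cmod w)"
      using complex_norm_square[of w] w by (simp add: sgn_eq field_simps power2_eq_square)
    then have "Re (cblinfun_apply \<phi> ((cnj (sgn w) / norm x) *\<^sub>C x)) = cmod w / norm x"
      by (simp add: cblinfun_apply_scaleC scaleC_complex_def w_def[symmetric])
    moreover have "norm ((cnj (sgn w) / norm x) *\<^sub>C x) \<le> 1"
      using x w by (simp add: norm_scaleC norm_divide norm_sgn)
    ultimately have "cmod w / norm x \<le> M" using le by metis
    then show ?thesis using x by (simp add: w_def field_simps)
  qed
qed

lemma bidual_apply_lp:
  fixes x'' :: "nat \<Rightarrow> ('a::complex_normed_vector, 'b::complex_normed_vector) cblinfun"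
  assumes "0 < p" "x'' \<in> lp p"
  shows "(\<lambda>n. cblinfun_apply (x'' n) y) \<in> lp p"
    "lp_norm p (\<lambda>n. cblinfun_apply (x'' n) y) \<le> norm y * lp_norm p x''"
  using lp_dominated[OF assms(2,1), of "norm y" "\<lambda>n. cblinfun_apply (x'' n) y"] norm_cblinfun_apply
  by (auto simp: mult.commute)

section \<open>Domination in the bidual\<close>

definition bidual_dominating :: "real \<Rightarrow> 'a::complex_normed_vector set \<Rightarrow> (nat \<Rightarrow> 'a cdual cdual) set"
  where "bidual_dominating p K = {x'' \<in> lp p. \<forall>z\<in>K. \<forall>y' :: 'a cdual.
    cmod (cblinfun_apply y' z) \<le> lp_norm p (\<lambda>n. cblinfun_apply (x'' n) y')}"

lemma bidual_representation:
  fixes K :: "'a::complex_normed_vector set"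
  assumes p: "1 \<le> p" and x'': "x'' \<in> bidual_dominating p K" and "z \<in> K"
  obtains \<alpha> where "\<alpha> \<in> conjugate_ball p"
    "\<And>y'. cblinfun_apply y' z = (\<Sum>n. \<alpha> n * cblinfun_apply (x'' n) y')"
proof (rule dominated_functional_representation[OF p])
  show "clinear (\<lambda>y' :: 'a cdual. cblinfun_apply y' z)"
    by (simp add: clinear_def plus_cblinfun.rep_eq scaleC_cblinfun.rep_eq)
  show "(\<lambda>n. cblinfun_apply (x'' n) y') \<in> lp p" for y'
    using p x'' by (intro bidual_apply_lp) (auto simp: bidual_dominating_def)
  show "cmod (cblinfun_apply y' z) \<le> lp_norm p (\<lambda>n. cblinfun_apply (x'' n) y')" for y'
    using x'' \<open>z \<in> K\<close> by (simp add: bidual_dominating_def)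
qed (use that clinear_cblinfun in blast)+

text \<open>A functional supporting the infimal convolution of the error seminorm \<open>q\<close> and the \<open>\<ell>\<^sub>p\<close>-norm of
  \<open>u\<close> at the point \<open>(z)\<^sub>z\<close> is given by \<open>(Y z)\<^sub>z\<close> in the dual; its value there is
  \<open>\<Sum> x''\<^sub>n(\<phi>\<^sub>n)\<close>, which is at most the norm of \<open>x''\<close>.\<close>

lemma finite_bidual_approximation:
  fixes Z :: "'a::complex_banach set" and x'' :: "nat \<Rightarrow> 'a cdual cdual"
  assumes p: "1 \<le> p" and "finite Z" and x'': "x'' \<in> lp p"
    and \<alpha>: "\<And>z. z \<in> Z \<Longrightarrow> \<alpha> z \<in> conjugate_ball p"
    and rep: "\<And>z y'. z \<in> Z \<Longrightarrow> cblinfun_apply y' z = (\<Sum>n. \<alpha> z n * cblinfun_apply (x'' n) y')"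
    and "0 < d"
  obtains u where "u \<in> lp p" "lp_norm p u \<le> lp_norm p x'' + d"
    "\<And>z. z \<in> Z \<Longrightarrow> norm (z - (\<Sum>n. \<alpha> z n *\<^sub>C u n)) \<le> d"
proof -
  have p0: "0 < p" using p by simp
  define c where "c = lp_norm p x''"
  \<comment> \<open>The weight of the error in \<open>q\<close>: a total below \<open>c + d\<close>
    forces an error of at most \<open>(c + d) / D = d\<close>.\<close>
  define D where "D = (c + d) / d"
  have "c + d > 0"
    using \<open>0 < d\<close> by (simp add: c_def add_nonneg_pos)
  then have D: "D > 0" "c + d > 0"
    using \<open>0 < d\<close> by (auto simp: D_def)
  define q :: "('a \<Rightarrow> 'a) \<Rightarrow> real" where "q v = D * (\<Sum>z\<in>Z. norm (v z))" for v
  have q: "sublinear q"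
    unfolding sublinear_def
  proof (intro conjI allI impI)
    show "q (u + v) \<le> q u + q v" for u v
      using D by (simp add: q_def distrib_left[symmetric] sum.distrib[symmetric] sum_mono norm_triangle_ineq)
    show "q (t *\<^sub>R v) = t * q v" if "0 \<le> t" for t v
      using that by (simp add: q_def sum_distrib_left[symmetric])
  qed
  define A where "A u = (\<lambda>z. if z \<in> Z then \<Sum>n. \<alpha> z n *\<^sub>C u n else 0)" for u :: "nat \<Rightarrow> 'a"
  have sm: "summable (\<lambda>n. \<alpha> z n *\<^sub>C u n)" if "z \<in> Z" "u \<in> lp p" for z and u :: "nat \<Rightarrow> 'a"
    by (rule summable_norm_cancel[OF summable_norm_scaleC_conjugate_ball[OF p \<alpha>[OF that(1)] that(2)]])
  \<comment> \<open>Families \<open>A u\<close> paired with bounds on their cost. Thus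
    \<open>inf_conv q C id\<close> is the infimum of weighted error plus cost when the family of all
    \<open>z \<in> Z\<close> is approximated.\<close>
  define C where "C = {(A u, r) | u r. u \<in> lp p \<and> lp_norm p u \<le> r}"
  have C: "convex_cone C"
    unfolding convex_cone_iff
  proof (intro conjI ballI allI impI)
    have "0 \<in> (lp p :: (nat \<Rightarrow> 'a) set)" "lp_norm p (0 :: nat \<Rightarrow> 'a) \<le> 0" "A 0 = 0"
      using scaleC_minus_right(2)[of _ "0::'a" 0]
      by (auto simp: lp_def lp_norm_def A_def fun_eq_iff)
    then show "0 \<in> C" by (force simp: C_def zero_prod_def)
    fix a b assume "a \<in> C" "b \<in> C"
    then obtain u r v s where uv: "a = (A u, r)" "u \<in> lp p" "lp_norm p u \<le> r"
        "b = (A v, s)" "v \<in> lp p" "lp_norm p v \<le> s"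
      by (auto simp: C_def)
    have "A u + A v = A (\<lambda>n. u n + v n)"
      using suminf_add[OF sm sm] uv(2,5) by (auto simp: A_def fun_eq_iff scaleC_add_right)
    moreover have "lp_norm p (\<lambda>n. u n + v n) \<le> r + s"
      using lp_add(2)[OF p uv(2,5)] uv(3,6) by simp
    ultimately show "a + b \<in> C"
      using lp_add(1)[OF p uv(2,5)] by (auto simp: C_def uv(1,4))
  next
    fix a :: "('a \<Rightarrow> 'a) \<times> real" and t :: real assume "a \<in> C" "0 \<le> t"
    then obtain u r where u: "a = (A u, r)" "u \<in> lp p" "lp_norm p u \<le> r"
      by (auto simp: C_def)
    have "t *\<^sub>R A u = A (\<lambda>n. t *\<^sub>R u n)"
      using suminf_scaleR_right[OF sm] u(2) by (auto simp: A_def fun_eq_iff scaleC_scaleR_commute)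
    moreover have "lp_norm p (\<lambda>n. t *\<^sub>R u n) \<le> t * r"
      using lp_scaleR(2)[OF p0 u(2), of t] u(3) \<open>0 \<le> t\<close> by (simp add: mult_left_mono)
    ultimately show "t *\<^sub>R a \<in> C"
      using lp_scaleR(1)[OF p0 u(2), of t] by (auto simp: C_def u(1))
  qed
  have q_nonneg: "0 \<le> q v" for v using D by (simp add: q_def sum_nonneg)
  have nonneg: "0 \<le> q (- w) + r" if "(w, r) \<in> C" for w r
  proof -
    have "0 \<le> r" using that by (auto simp: C_def intro: order_trans[OF lp_norm_nonneg])
    then show ?thesis using q_nonneg[of "- w"] by simp
  qed
  define s where "s = inf_conv q C"
  obtain L where L: "linear L" "\<And>v. L v \<le> s v" "L id = s id"
    using Hahn_Banach_support[of s id] sublinear_inf_conv[of q C] q C nonneg unfolding s_def by blast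
  have L_q: "L v \<le> q v" for v
    using L(2)[of v] inf_conv_le[of q C v] q C nonneg unfolding s_def by fastforce
  have L_A: "L (A u) \<le> lp_norm p u" if "u \<in> lp p" for u
  proof -
    have "(A u, lp_norm p u) \<in> C" using that by (auto simp: C_def)
    then have "s (A u) \<le> q (A u - A u) + lp_norm p u"
      unfolding s_def by (intro inf_conv_lower q C nonneg)
    then show ?thesis using L(2)[of "A u"] sublinear_zero[OF q] by simp
  qed
  define single where "single z x = (\<lambda>w. if w = z then x else 0)" for z x :: 'a
  have "\<exists>y' :: 'a cdual. \<forall>x. Re (cblinfun_apply y' x) = L (single z x)" if "z \<in> Z" for z
  proof -
    have "linear (\<lambda>x. L (single z x))"
    proof (rule linearI)
      have "single z (x + y) = single z x + single z y" for x y
        by (auto simp: single_def fun_eq_iff)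
      then show "L (single z (x + y)) = L (single z x) + L (single z y)" for x y
        by (simp only: linear_add[OF L(1)])
      have "single z (t *\<^sub>R x) = t *\<^sub>R single z x" for t x
        by (auto simp: single_def fun_eq_iff)
      then show "L (single z (t *\<^sub>R x)) = t *\<^sub>R L (single z x)" for t x
        by (simp only: linear_scale[OF L(1)])
    qed
    moreover have "L (single z x) \<le> D * norm x" for x
      using L_q[of "single z x"] that \<open>finite Z\<close>
      by (simp add: q_def single_def if_distrib sum.delta cong: if_cong)
    ultimately show ?thesis
      using complexify_real_functional[of "\<lambda>x. L (single z x)" D] D(1) by (metis less_imp_le)
  qed
  then obtain Y :: "'a \<Rightarrow> 'a cdual" where Y: "\<And>z x. z \<in> Z \<Longrightarrow> Re (cblinfun_apply (Y z) x) = L (single z x)"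
    by metis
  have L_eq: "L v = (\<Sum>z\<in>Z. Re (cblinfun_apply (Y z) (v z)))" for v
  proof -
    define vS where "vS S = (\<lambda>z. if z \<in> S then v z else 0)" for S
    have "L (vS S) = (\<Sum>z\<in>S. L (single z (v z)))" if "finite S" for S
      using that
    proof induction
      case empty
      have "vS {} = 0" by (simp add: vS_def fun_eq_iff)
      then show ?case by (simp only: linear_0[OF L(1)]) simp
    next
      case (insert z S)
      have "vS (insert z S) = single z (v z) + vS S"
        using insert.hyps by (auto simp: vS_def single_def fun_eq_iff)
      then have "L (vS (insert z S)) = L (single z (v z)) + L (vS S)"
        by (simp only: linear_add[OF L(1)])
      then show ?case using insert by simp
    qed
    then have "L (vS Z) = (\<Sum>z\<in>Z. Re (cblinfun_apply (Y z) (v z)))"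
      using \<open>finite Z\<close> Y by simp
    \<comment> \<open>\<open>q\<close> vanishes on functions that are zero on \<open>Z\<close>,
      hence so does \<open>L\<close>.\<close>
    moreover have "L (v - vS Z) \<le> 0" "L (vS Z - v) \<le> 0"
      using L_q[of "v - vS Z"] L_q[of "vS Z - v"] by (auto simp: q_def vS_def)
    ultimately show ?thesis by (simp add: linear_diff[OF L(1)])
  qed
  define \<phi> where "\<phi> n = (\<Sum>z\<in>Z. \<alpha> z n *\<^sub>C Y z)" for n
  have \<phi>_apply: "cblinfun_apply (\<phi> n) x = (\<Sum>z\<in>Z. \<alpha> z n * cblinfun_apply (Y z) x)" for n x
    by (simp add: \<phi>_def cblinfun_apply_sum scaleC_cblinfun.rep_eq scaleC_complex_def)
  \<comment> \<open>For finitely supported \<open>u\<close>, \<open>L (A u)\<close> is the sum of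
    \<open>Re (cblinfun_apply (\<phi> n) (u n))\<close> and is at most the norm of \<open>u\<close>.
    Taking \<open>u n\<close> along vectors that nearly norm \<open>\<phi> n\<close> bounds the
    sequence of norms.\<close>
  have \<phi>: "(\<lambda>n. complex_of_real (norm (\<phi> n))) \<in> conjugate_ball p"
  proof (rule conjugate_ballI[OF p])
    fix N and v :: "nat \<Rightarrow> real" assume v: "\<And>n. 0 \<le> v n"
    have *: "(\<Sum>n<N. v n * (norm (\<phi> n) - t)) \<le> (\<Sum>n<N. v n powr p) powr (1 / p)" if "t > 0" for t
    proof -
      have "\<exists>x. norm x \<le> 1 \<and> norm (\<phi> n) - t \<le> Re (cblinfun_apply (\<phi> n) x)" for n
        using norm_cdual_le_ReI[of "\<phi> n" "norm (\<phi> n) - t"] that by force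
      then obtain X where X: "\<And>n. norm (X n) \<le> 1" "\<And>n. norm (\<phi> n) - t \<le> Re (cblinfun_apply (\<phi> n) (X n))"
        by metis
      define u where "u n = (if n < N then v n *\<^sub>R X n else 0)" for n
      have u: "u \<in> lp p" "lp_norm p u = (\<Sum>n<N. norm (u n) powr p) powr (1 / p)"
        by (rule lp_finite_support[OF p0, of N]; simp add: u_def)+
      have "(\<Sum>n<N. v n * (norm (\<phi> n) - t)) \<le> (\<Sum>n<N. v n * Re (cblinfun_apply (\<phi> n) (X n)))"
        using v X(2) by (intro sum_mono mult_left_mono) auto
      also have "\<dots> = (\<Sum>n<N. \<Sum>z\<in>Z. Re (\<alpha> z n * cblinfun_apply (Y z) (u n)))"
        by (intro sum.cong refl)
          (simp add: \<phi>_apply u_def linear_scale[OF clinear_imp_linear[OF clinear_cblinfun]] sum_distrib_left algebra_simps)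
      also have "\<dots> = (\<Sum>z\<in>Z. Re (\<Sum>n<N. \<alpha> z n * cblinfun_apply (Y z) (u n)))"
        by (subst sum.swap) simp
      also have "\<dots> = L (A u)"
        unfolding L_eq
      proof (intro sum.cong refl)
        fix z assume "z \<in> Z"
        have "\<alpha> z n *\<^sub>C u n = 0" if "n \<notin> {..<N}" for n
          using that scaleC_minus_right(2)[of "\<alpha> z n" "0::'a" 0] by (simp add: u_def)
        then have "(\<Sum>n. \<alpha> z n *\<^sub>C u n) = (\<Sum>n<N. \<alpha> z n *\<^sub>C u n)"
          by (intro suminf_finite) auto
        then have "A u z = (\<Sum>n<N. \<alpha> z n *\<^sub>C u n)"
          using \<open>z \<in> Z\<close> by (simp add: A_def)
        then show "Re (\<Sum>n<N. \<alpha> z n * cblinfun_apply (Y z) (u n)) = Re (cblinfun_apply (Y z) (A u z))"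
          by (simp add: linear_sum[OF clinear_imp_linear[OF clinear_cblinfun]] cblinfun_apply_scaleC scaleC_complex_def)
      qed
      also have "\<dots> \<le> lp_norm p u" by (rule L_A[OF u(1)])
      also have "\<dots> \<le> (\<Sum>n<N. v n powr p) powr (1 / p)"
        unfolding u(2) using p v X(1)
        by (intro powr_mono2 sum_mono) (auto simp: u_def mult_left_le intro: sum_nonneg)
      finally show ?thesis .
    qed
    have "(\<Sum>n<N. v n * norm (\<phi> n)) \<le> (\<Sum>n<N. v n powr p) powr (1 / p)"
    proof (rule field_le_epsilon)
      fix e :: real assume "e > 0"
      \<comment> \<open>The slack \<open>t = e / V\<close> costs at most \<open>e\<close> in total;
        the added 1 keeps \<open>V\<close> positive.\<close>
      define V where "V = (\<Sum>n<N. v n) + 1"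
      have V: "V > 0" using v by (simp add: V_def add_nonneg_pos sum_nonneg)
      have "(\<Sum>n<N. v n * norm (\<phi> n)) - (\<Sum>n<N. v n) * (e / V) = (\<Sum>n<N. v n * (norm (\<phi> n) - e / V))"
        by (simp add: right_diff_distrib sum_subtractf sum_distrib_right sum_divide_distrib)
      also have "\<dots> \<le> (\<Sum>n<N. v n powr p) powr (1 / p)"
        using \<open>e > 0\<close> V by (intro *) simp
      moreover have "(\<Sum>n<N. v n) * (e / V) \<le> e"
        using \<open>e > 0\<close> V by (simp add: field_simps V_def)
      ultimately show "(\<Sum>n<N. v n * norm (\<phi> n)) \<le> (\<Sum>n<N. v n powr p) powr (1 / p) + e"
        by linarith
    qed
    then show "(\<Sum>n<N. cmod (complex_of_real (norm (\<phi> n))) * v n) \<le> (\<Sum>n<N. v n powr p) powr (1 / p)"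
      by (simp add: mult.commute)
  qed
  have "L id \<le> c"
  proof -
    have "(\<lambda>n. \<alpha> z n * cblinfun_apply (x'' n) (Y z)) sums cblinfun_apply (Y z) z" if "z \<in> Z" for z
      unfolding rep[OF that]
      using summable_norm_scaleC_conjugate_ball[OF p \<alpha>[OF that] bidual_apply_lp(1)[OF p0 x'', of "Y z"]]
      by (intro summable_sums summable_norm_cancel[of "\<lambda>n. \<alpha> z n * cblinfun_apply (x'' n) (Y z)"])
        (simp add: scaleC_complex_def)
    then have "(\<lambda>n. \<Sum>z\<in>Z. \<alpha> z n * cblinfun_apply (x'' n) (Y z)) sums (\<Sum>z\<in>Z. cblinfun_apply (Y z) z)"
      by (rule sums_sum)
    moreover have "(\<Sum>z\<in>Z. \<alpha> z n * cblinfun_apply (x'' n) (Y z)) = cblinfun_apply (x'' n) (\<phi> n)" for n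
      by (simp add: \<phi>_def linear_sum[OF clinear_imp_linear[OF clinear_cblinfun]] cblinfun_apply_scaleC scaleC_complex_def)
    ultimately have sums: "(\<lambda>n. cblinfun_apply (x'' n) (\<phi> n)) sums (\<Sum>z\<in>Z. cblinfun_apply (Y z) z)"
      by simp
    note H = Hoelder_conjugate_ball[OF p \<phi> x'']
    have le: "cmod (cblinfun_apply (x'' n) (\<phi> n)) \<le> cmod (complex_of_real (norm (\<phi> n))) * norm (x'' n)" for n
      using norm_cblinfun_apply[of "x'' n" "\<phi> n"] by (simp add: mult.commute)
    have "L id = Re (\<Sum>z\<in>Z. cblinfun_apply (Y z) z)" by (simp add: L_eq)
    also have "\<dots> \<le> cmod (\<Sum>n. cblinfun_apply (x'' n) (\<phi> n))"
      unfolding sums_unique[OF sums] by (rule complex_Re_le_cmod)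
    also have "\<dots> \<le> (\<Sum>n. cmod (complex_of_real (norm (\<phi> n))) * norm (x'' n))"
      by (rule norm_suminf_le[OF le H(1)])
    also have "\<dots> \<le> c" using H(2) by (simp add: c_def)
    finally show ?thesis .
  qed
  \<comment> \<open>The supporting value \<open>L id\<close> is the infimum itself, so a bound by
    \<open>c\<close> yields an actual pair in \<open>C\<close> with total below
    \<open>c + d\<close>.\<close>
  then have "inf_conv q C id < c + d" using L(3) \<open>0 < d\<close> by (simp add: s_def)
  then obtain w r where wr: "(w, r) \<in> C" "q (id - w) + r < c + d"
    using inf_conv_less[of q C id "c + d"] q C nonneg by blast
  then obtain u where u: "w = A u" "u \<in> lp p" "lp_norm p u \<le> r" by (auto simp: C_def)
  show thesis
  proof (rule that[OF u(2)])
    show "lp_norm p u \<le> lp_norm p x'' + d"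
      using wr(2) u(3) q_nonneg[of "id - w"] by (simp add: c_def)
    fix z assume "z \<in> Z"
    have "norm (z - A u z) \<le> (\<Sum>z\<in>Z. norm (z - A u z))"
      by (rule member_le_sum[OF \<open>z \<in> Z\<close> _ \<open>finite Z\<close>]) simp
    also have "\<dots> = q (id - w) / D"
      using D by (simp add: q_def u(1))
    also have "\<dots> \<le> (c + d) / D"
      using wr(2) order_trans[OF lp_norm_nonneg u(3)] D by (intro divide_right_mono) auto
    also have "\<dots> = d" using D \<open>0 < d\<close> by (simp add: D_def)
    finally show "norm (z - (\<Sum>n. \<alpha> z n *\<^sub>C u n)) \<le> d"
      using \<open>z \<in> Z\<close> by (simp add: A_def)
  qed
qed

section \<open>From the bidual to the space\<close>

text \<open>Countable subadditivity of \<open>m_p\<close>: the sequences \<open>u i\<close> are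
  divided by \<open>c i\<close> and concatenated, while the coefficients of the summands are
  multiplied by \<open>c i\<close>. Weights come from the strict bounds
  \<open>\<delta> i > 0\<close>, so none is zero.\<close>

lemma p_co_countable_sum:
  fixes u :: "nat \<Rightarrow> nat \<Rightarrow> 'a::complex_banach"
  assumes p: "1 \<le> p" and u: "\<And>i. u i \<in> lp p" "\<And>i. lp_norm p (u i) \<le> \<delta> i"
    and \<delta>: "\<And>i. 0 < \<delta> i" "\<delta> sums s"
  obtains y where "y \<in> lp p" "lp_norm p y \<le> s"
    "\<And>a. (\<And>i. a i \<in> p_co p (u i)) \<Longrightarrow> suminf a \<in> p_co p y"
proof -
  have p0: "0 < p" using p by simp
  have s: "0 < s" using \<delta> suminf_pos[of \<delta>] by (simp add: sums_iff)
  \<comment> \<open>Equality case of Hoelder: \<open>\<Sum> c\<^sub>i\<^sup>q = 1\<close> and \<open>\<Sum> (\<delta>\<^sub>i / c\<^sub>i)\<^sup>p = s\<^sup>p\<close>.\<close>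
  define c where "c i = (\<delta> i / s) powr (1 - 1 / p)" for i
  have c: "0 < c i" for i using \<delta>(1) s by (auto simp: c_def less_imp_neq[symmetric])
  define y where "y k = (case prod_decode k of (i, n) \<Rightarrow> (1 / c i) *\<^sub>R u i n)" for k
  have row_lp: "(\<lambda>n. (1 / c i) *\<^sub>R u i n) \<in> lp p" for i
    by (rule lp_scaleR(1)[OF p0 u(1)])
  have row_y: "summable (\<lambda>n. norm ((1 / c i) *\<^sub>R u i n) powr p)"
    "(\<Sum>n. norm ((1 / c i) *\<^sub>R u i n) powr p) \<le> \<delta> i * s powr (p - 1)" for i
  proof -
    show "summable (\<lambda>n. norm ((1 / c i) *\<^sub>R u i n) powr p)" using row_lp[of i] by (simp add: lp_def)
    have "(\<Sum>n. norm ((1 / c i) *\<^sub>R u i n) powr p) = (lp_norm p (u i) / c i) powr p"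
      using lp_norm_powr[OF row_lp[of i] p0] lp_scaleR(2)[OF p0 u(1), of "1 / c i" i] c[of i] by simp
    also have "\<dots> \<le> (\<delta> i / c i) powr p"
      using u(2)[of i] c[of i] p by (intro powr_mono2 divide_right_mono) auto
    also have "\<dots> = \<delta> i powr p / c i powr p"
      using \<delta>(1)[of i] c[of i] by (simp add: powr_divide)
    also have "c i powr p = (\<delta> i / s) powr (p - 1)"
      using p0 by (simp add: c_def powr_powr left_diff_distrib)
    also have "\<delta> i powr p / (\<delta> i / s) powr (p - 1) = \<delta> i * s powr (p - 1)"
      using \<delta>(1)[of i] s by (simp add: powr_divide powr_diff)
    finally show "(\<Sum>n. norm ((1 / c i) *\<^sub>R u i n) powr p) \<le> \<delta> i * s powr (p - 1)" .
  qed
  have \<delta>': "(\<lambda>i. \<delta> i * s powr (p - 1)) sums (s powr p)"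
    using sums_mult2[OF \<delta>(2), of "s powr (p - 1)"] s by (simp add: powr_diff)
  have "summable (\<lambda>i. \<Sum>n. norm ((1 / c i) *\<^sub>R u i n) powr p)"
    by (rule summable_comparison_test'[OF sums_summable[OF \<delta>'], of 0])
      (use row_y in \<open>simp add: suminf_nonneg\<close>)
  have y_eq: "norm (y k) powr p = (case prod_decode k of (i, n) \<Rightarrow> norm ((1 / c i) *\<^sub>R u i n) powr p)" for k
    by (simp add: y_def split: prod.split)
  have "summable (\<lambda>k. norm (y k) powr p)"
    using suminf_double(1)[of "\<lambda>i n. norm ((1 / c i) *\<^sub>R u i n) powr p"] row_y
      \<open>summable (\<lambda>i. \<Sum>n. norm ((1 / c i) *\<^sub>R u i n) powr p)\<close>
    unfolding y_eq by (simp add: case_prod_beta)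
  moreover have "(\<Sum>k. norm (y k) powr p) \<le> s powr p"
  proof -
    have "(\<lambda>i. \<Sum>n. norm ((1 / c i) *\<^sub>R u i n) powr p) sums (\<Sum>k. norm (y k) powr p)"
      using suminf_double(2)[of "\<lambda>i n. norm ((1 / c i) *\<^sub>R u i n) powr p"] row_y
        \<open>summable (\<lambda>i. \<Sum>n. norm ((1 / c i) *\<^sub>R u i n) powr p)\<close>
      unfolding y_eq by simp
    from sums_le[OF row_y(2) this \<delta>'] show ?thesis .
  qed
  ultimately have y: "y \<in> lp p" "lp_norm p y \<le> s"
    using lp_norm_suminf_leI[OF p0, of s y] s by auto
  show thesis
  proof (rule that[OF y])
    fix a assume "\<And>i. a i \<in> p_co p (u i)"
    then have "\<exists>\<beta>. \<beta> \<in> conjugate_ball p \<and> a i = (\<Sum>n. \<beta> n *\<^sub>C u i n)" for i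
      unfolding p_co_def by blast
    then obtain \<beta> where \<beta>: "\<And>i. \<beta> i \<in> conjugate_ball p" "\<And>i. a i = (\<Sum>n. \<beta> i n *\<^sub>C u i n)"
      by metis
    define \<alpha> where "\<alpha> k = (case prod_decode k of (i, n) \<Rightarrow> complex_of_real (c i) * \<beta> i n)" for k
    have "\<alpha> \<in> conjugate_ball p"
    proof (cases "p = 1")
      \<comment> \<open>The exponent in the definition of \<open>c\<close> is 0 here, so every
        \<open>c i\<close> equals 1.\<close>
      case True
      then have "cmod (\<alpha> k) \<le> 1" for k
        using conjugate_ball_cmod_le_1[OF p \<beta>(1)] \<delta>(1) s
        by (auto simp: \<alpha>_def c_def norm_mult split: prod.split)
      then show ?thesis using True by (simp add: conjugate_ball_def)
    next
      case False
      then have p1: "1 < p" using p by simp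
      define q where "q = p / (p - 1)"
      have q: "0 < q" "(1 - 1 / p) * q = 1" using p1 by (auto simp: q_def field_simps)
      have \<beta>q: "\<beta> i \<in> lp q" "lp_norm q (\<beta> i) \<le> 1" for i
        using \<beta>(1)[of i] False by (auto simp: conjugate_ball_def q_def Let_def)
      have row_lp: "(\<lambda>n. c i *\<^sub>R \<beta> i n) \<in> lp q" for i
        by (rule lp_scaleR(1)[OF q(1) \<beta>q(1)])
      have row: "summable (\<lambda>n. cmod (c i *\<^sub>R \<beta> i n) powr q)"
        "(\<Sum>n. cmod (c i *\<^sub>R \<beta> i n) powr q) \<le> \<delta> i / s" for i
      proof -
        show "summable (\<lambda>n. cmod (c i *\<^sub>R \<beta> i n) powr q)" using row_lp[of i] by (simp add: lp_def)
        have "(\<Sum>n. cmod (c i *\<^sub>R \<beta> i n) powr q) = (c i * lp_norm q (\<beta> i)) powr q"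
          using lp_norm_powr[OF row_lp[of i] q(1)] lp_scaleR(2)[OF q(1) \<beta>q(1), of "c i" i] c[of i] by simp
        also have "\<dots> \<le> (c i * 1) powr q"
          using \<beta>q(2)[of i] c[of i] q by (intro powr_mono2 mult_left_mono) auto
        also have "\<dots> = \<delta> i / s"
          using q \<delta>(1)[of i] s by (simp add: c_def powr_powr)
        finally show "(\<Sum>n. cmod (c i *\<^sub>R \<beta> i n) powr q) \<le> \<delta> i / s" .
      qed
      have \<delta>'': "(\<lambda>i. \<delta> i / s) sums 1"
        using sums_divide[OF \<delta>(2), of s] s by simp
      have sm: "summable (\<lambda>i. \<Sum>n. cmod (c i *\<^sub>R \<beta> i n) powr q)"
        by (rule summable_comparison_test'[OF sums_summable[OF \<delta>''], of 0])
          (use row in \<open>simp add: suminf_nonneg\<close>)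
      have \<alpha>_eq: "cmod (\<alpha> k) powr q = (case prod_decode k of (i, n) \<Rightarrow> cmod (c i *\<^sub>R \<beta> i n) powr q)" for k
        by (simp add: \<alpha>_def norm_mult split: prod.split)
      have "summable (\<lambda>k. cmod (\<alpha> k) powr q)"
        using suminf_double(1)[of "\<lambda>i n. cmod (c i *\<^sub>R \<beta> i n) powr q"] row sm
        unfolding \<alpha>_eq by (simp add: case_prod_beta)
      moreover have "(\<lambda>i. \<Sum>n. cmod (c i *\<^sub>R \<beta> i n) powr q) sums (\<Sum>k. cmod (\<alpha> k) powr q)"
        using suminf_double(2)[of "\<lambda>i n. cmod (c i *\<^sub>R \<beta> i n) powr q"] row sm
        unfolding \<alpha>_eq by simp
      from sums_le[OF row(2) this \<delta>''] have "(\<Sum>k. cmod (\<alpha> k) powr q) \<le> 1 powr q" by simp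
      ultimately have "\<alpha> \<in> lp q" "lp_norm q \<alpha> \<le> 1"
        using lp_norm_suminf_leI[OF q(1), of 1 \<alpha>] by auto
      then show ?thesis using False by (simp add: conjugate_ball_def q_def Let_def)
    qed
    moreover have "suminf a = (\<Sum>k. \<alpha> k *\<^sub>C y k)"
    proof -
      have row: "summable (\<lambda>n. norm (\<beta> i n *\<^sub>C u i n))" "(\<Sum>n. norm (\<beta> i n *\<^sub>C u i n)) \<le> \<delta> i" for i
        using Hoelder_conjugate_ball[OF p \<beta>(1) u(1), of i i] u(2)[of i] by (simp_all add: norm_scaleC)
      have "summable (\<lambda>i. \<Sum>n. norm (\<beta> i n *\<^sub>C u i n))"
        by (rule summable_comparison_test'[OF sums_summable[OF \<delta>(2)], of 0])
          (use row in \<open>simp add: suminf_nonneg\<close>)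
      from suminf_double(2)[of "\<lambda>i n. \<beta> i n *\<^sub>C u i n", OF row(1) this]
      have "a sums (\<Sum>k. case_prod (\<lambda>i n. \<beta> i n *\<^sub>C u i n) (prod_decode k))"
        by (simp add: \<beta>(2)[symmetric])
      moreover have "\<alpha> k *\<^sub>C y k = case_prod (\<lambda>i n. \<beta> i n *\<^sub>C u i n) (prod_decode k)" for k
        using c by (auto simp: \<alpha>_def y_def scaleC_of_real[symmetric] scaleC_scaleC less_imp_neq[symmetric]
          mult.commute split: prod.split)
      ultimately show ?thesis by (simp add: sums_iff)
    qed
    ultimately show "suminf a \<in> p_co p y" unfolding p_co_def by blast
  qed
qed

lemma zero_in_p_co: "0 \<in> p_co p u"
proof -
  have "(\<lambda>_. 0) \<in> conjugate_ball p"
    by (simp add: conjugate_ball_def Let_def lp_def lp_norm_def)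
  moreover have "0 *\<^sub>C x = 0" for x :: 'a
    using scaleC_of_real[of 0 x] by simp
  then have "(\<Sum>n. 0 *\<^sub>C u n) = 0" by simp
  ultimately show ?thesis unfolding p_co_def by force
qed

text \<open>The approximation of the finite set is made exact by adding each error as a one-term
  sequence of its own; \<open>p_co_countable_sum\<close> joins these to \<open>u\<close> at a total
  extra cost of \<open>\<epsilon>\<close>.\<close>

lemma finite_subset_p_co:
  fixes Z :: "'a::complex_banach set"
  assumes p: "1 \<le> p" and "finite Z" and x'': "x'' \<in> bidual_dominating p Z" and "0 < \<epsilon>"
  obtains u where "u \<in> lp p" "lp_norm p u \<le> lp_norm p x'' + \<epsilon>" "Z \<subseteq> p_co p u"
proof -
  have p0: "0 < p" using p by simp
  have x''_lp: "x'' \<in> lp p" using x'' by (simp add: bidual_dominating_def)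
  have "\<exists>\<alpha>. \<alpha> \<in> conjugate_ball p \<and> (\<forall>y'. cblinfun_apply y' z = (\<Sum>n. \<alpha> n * cblinfun_apply (x'' n) y'))"
    if "z \<in> Z" for z
    using bidual_representation[OF p x'' that] by metis
  then obtain \<alpha> where \<alpha>: "\<And>z. z \<in> Z \<Longrightarrow> \<alpha> z \<in> conjugate_ball p"
    and rep: "\<And>z y'. z \<in> Z \<Longrightarrow> cblinfun_apply y' z = (\<Sum>n. \<alpha> z n * cblinfun_apply (x'' n) y')"
    by metis
  obtain h where h: "bij_betw h {0..<card Z} Z"
    using ex_bij_betw_nat_finite[OF \<open>finite Z\<close>] by blast
  \<comment> \<open>Errors occupy positions 1 to \<open>card Z\<close>, and position
    \<open>i\<close> has budget \<open>\<epsilon> / 2 * (1 / 2) ^ i\<close>, which is at least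
    \<open>d\<close>.\<close>
  define d where "d = \<epsilon> / 2 * (1 / 2) ^ card Z"
  have d: "0 < d" "d \<le> \<epsilon> / 2"
    using \<open>0 < \<epsilon>\<close> by (auto simp: d_def power_le_one mult_left_le)
  obtain u where u: "u \<in> lp p" "lp_norm p u \<le> lp_norm p x'' + d"
    "\<And>z. z \<in> Z \<Longrightarrow> norm (z - (\<Sum>n. \<alpha> z n *\<^sub>C u n)) \<le> d"
    using finite_bidual_approximation[OF p \<open>finite Z\<close> x''_lp \<alpha> rep d(1)] by blast
  define err where "err z = z - (\<Sum>n. \<alpha> z n *\<^sub>C u n)" for z
  \<comment> \<open>Position 0 holds \<open>u\<close>, position \<open>Suc j\<close> the error of
    the element numbered \<open>j\<close>; all later positions hold the zero sequence.\<close>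
  define U where "U i = (case i of 0 \<Rightarrow> u
    | Suc j \<Rightarrow> (\<lambda>n. if n = 0 \<and> j < card Z then err (h j) else 0))" for i
  define \<delta> where "\<delta> i = (if i = 0 then lp_norm p x'' + \<epsilon> / 2 else \<epsilon> / 2 * (1 / 2) ^ i)" for i :: nat
  have "U i \<in> lp p \<and> lp_norm p (U i) \<le> \<delta> i" for i
  proof (cases i)
    case 0
    then show ?thesis using u(1,2) d(2) by (simp add: U_def \<delta>_def)
  next
    case (Suc j)
    have "U i \<in> lp p" "lp_norm p (U i) = (\<Sum>n<1. norm (U i n) powr p) powr (1 / p)"
      by (rule lp_finite_support[OF p0, of 1]; simp add: U_def Suc)+
    moreover have "norm (U i 0) \<le> \<delta> i"
    proof (cases "j < card Z")
      case True
      then have "h j \<in> Z" using h by (auto simp: bij_betw_def)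
      then have "norm (U i 0) \<le> d" using u(3) True by (simp add: U_def Suc err_def)
      also have "\<dots> \<le> \<delta> i"
        using \<open>0 < \<epsilon>\<close> True Suc by (auto simp: d_def \<delta>_def intro!: mult_left_mono power_decreasing simp del: power_Suc)
      finally show ?thesis .
    qed (use \<open>0 < \<epsilon>\<close> in \<open>simp add: U_def Suc \<delta>_def\<close>)
    ultimately show ?thesis using p0 by (simp add: powr_powr)
  qed
  then have U: "\<And>i. U i \<in> lp p" "\<And>i. lp_norm p (U i) \<le> \<delta> i" by auto
  have \<delta>: "0 < \<delta> i" for i
    using \<open>0 < \<epsilon>\<close> by (simp add: \<delta>_def add_nonneg_pos)
  have "(\<lambda>i. \<delta> (Suc i)) sums (\<epsilon> / 2 * 1)"
    unfolding \<delta>_def using sums_mult[OF power_half_series, of "\<epsilon> / 2"] by simp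
  then have "\<delta> sums (\<epsilon> / 2 * 1 + \<delta> 0)"
    by (simp add: sums_Suc_iff)
  then have \<delta>_sums: "\<delta> sums (lp_norm p x'' + \<epsilon>)" by (simp add: \<delta>_def add_ac)
  obtain y where y: "y \<in> lp p" "lp_norm p y \<le> lp_norm p x'' + \<epsilon>"
    "\<And>a. (\<And>i. a i \<in> p_co p (U i)) \<Longrightarrow> suminf a \<in> p_co p y"
    using p_co_countable_sum[OF p U \<delta> \<delta>_sums] by blast
  show thesis
  proof (rule that[OF y(1,2)], rule subsetI)
    fix z assume z: "z \<in> Z"
    then obtain j where j: "j < card Z" "h j = z"
      using h by (force simp: bij_betw_def)
    define a where "a i = (if i = 0 then \<Sum>n. \<alpha> z n *\<^sub>C u n else if i = Suc j then err z else 0)" for i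
    have "a i \<in> p_co p (U i)" for i
    proof -
      have "(\<Sum>n. \<alpha> z n *\<^sub>C u n) \<in> p_co p (U 0)"
        using \<alpha>[OF z] by (auto simp: p_co_def U_def)
      moreover have "err z \<in> p_co p (U (Suc j))"
      proof -
        have "(\<Sum>n. (if n = 0 then 1 else 0) *\<^sub>C U (Suc j) n) = (\<Sum>n\<in>{0}. (if n = 0 then 1 else 0) *\<^sub>C U (Suc j) n)"
          by (rule suminf_finite) (use scaleC_of_real[of 0] in auto)
        also have "\<dots> = err z" using j by (simp add: U_def)
        finally show ?thesis
          unfolding p_co_def using unit_sequence_in_conjugate_ball[OF p, of 0] by force
      qed
      ultimately show ?thesis by (auto simp: a_def zero_in_p_co)
    qed
    then have "suminf a \<in> p_co p y" by (rule y(3))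
    moreover have "suminf a = (\<Sum>i\<in>{0, Suc j}. a i)"
      by (rule suminf_finite) (auto simp: a_def)
    then have "suminf a = z" by (simp add: a_def err_def)
    ultimately show "z \<in> p_co p y" by simp
  qed
qed

text \<open>Pigeonhole on a finite net \<open>C\<close> of the closed unit disc: rounding the first
  \<open>N\<close> coefficients to \<open>C\<close> takes finitely many values, and \<open>Z\<close>
  contains a representative of each.\<close>

lemma finite_coefficient_net:
  fixes f :: "'a \<Rightarrow> nat \<Rightarrow> complex"
  assumes f: "\<And>z n. z \<in> K \<Longrightarrow> cmod (f z n) \<le> 1" and "0 < \<eta>"
  obtains Z where "finite Z" "Z \<subseteq> K" "\<And>z. z \<in> K \<Longrightarrow> \<exists>w\<in>Z. \<forall>n<N. cmod (f z n - f w n) \<le> \<eta>"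
proof -
  obtain C where C: "finite C" "cball 0 1 \<subseteq> (\<Union>c\<in>C. ball (c :: complex) (\<eta> / 2))"
    using compact_cball[of "0::complex" 1] \<open>0 < \<eta>\<close> unfolding compact_eq_totally_bounded
    by (meson half_gt_zero)
  have "\<exists>c. c \<in> C \<and> dist c (f z n) < \<eta> / 2" if "z \<in> K" for z n
    using C(2) f[OF that, of n] by force
  then obtain b where b: "\<And>z n. z \<in> K \<Longrightarrow> b z n \<in> C \<and> dist (b z n) (f z n) < \<eta> / 2"
    by metis
  define h where "h z = restrict (b z) {..<N}" for z
  have "h z \<in> {..<N} \<rightarrow>\<^sub>E C" if "z \<in> K" for z
    using b[OF that] by (simp add: h_def restrict_PiE_iff)
  then have "h ` K \<subseteq> {..<N} \<rightarrow>\<^sub>E C" by blast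
  then have "finite (h ` K)"
    by (rule finite_subset) (use C(1) in \<open>simp add: finite_PiE\<close>)
  then obtain Z where Z: "Z \<subseteq> K" "finite Z" "h ` K = h ` Z"
    using finite_subset_image[of "h ` K" h K] by blast
  show thesis
  proof (rule that[OF Z(2,1)])
    fix z assume "z \<in> K"
    then obtain w where w: "w \<in> Z" "h z = h w" using Z(3) by blast
    have "cmod (f z n - f w n) \<le> \<eta>" if "n < N" for n
    proof -
      have "b z n = b w n" using fun_cong[OF w(2), of n] that by (simp add: h_def)
      then have "dist (f z n) (f w n) < \<eta> / 2 + \<eta> / 2"
        using b[OF \<open>z \<in> K\<close>, of n] b[of w n] w(1) Z(1)
        by (intro dist_triangle_less_add[of _ "b z n"]) (auto simp: dist_commute)
      then show ?thesis by (simp add: dist_norm)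
    qed
    with w(1) show "\<exists>w\<in>Z. \<forall>n<N. cmod (f z n - f w n) \<le> \<eta>" by blast
  qed
qed

text \<open>Each \<open>z\<close> is replaced by a representative \<open>g z\<close> in a finite
  subset of \<open>K\<close> with nearly the same first \<open>N\<close> coefficients. In the
  difference, the head is small because the coefficients are close, and the tail because
  \<open>x''\<close> has a small tail.\<close>

lemma bidual_dominating_step:
  fixes K :: "'a::complex_banach set"
  assumes p: "1 \<le> p" and x'': "x'' \<in> bidual_dominating p K" and "0 < \<epsilon>"
  obtains u g w'' where "u \<in> lp p" "lp_norm p u \<le> lp_norm p x'' + \<epsilon>"
    "\<And>z. z \<in> K \<Longrightarrow> g z \<in> p_co p u"
    "w'' \<in> bidual_dominating p ((\<lambda>z. z - g z) ` K)" "lp_norm p w'' \<le> \<epsilon>"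
proof -
  have p0: "0 < p" using p by simp
  have x''_lp: "x'' \<in> lp p" using x'' by (simp add: bidual_dominating_def)
  have "\<exists>\<alpha>. \<alpha> \<in> conjugate_ball p \<and> (\<forall>y'. cblinfun_apply y' z = (\<Sum>n. \<alpha> n * cblinfun_apply (x'' n) y'))"
    if "z \<in> K" for z
    using bidual_representation[OF p x'' that] by metis
  then obtain \<alpha> where \<alpha>: "\<And>z. z \<in> K \<Longrightarrow> \<alpha> z \<in> conjugate_ball p"
    and rep: "\<And>z y'. z \<in> K \<Longrightarrow> cblinfun_apply y' z = (\<Sum>n. \<alpha> z n * cblinfun_apply (x'' n) y')"
    by metis
  \<comment> \<open>The tail enters \<open>w''\<close> with factor 4, so
    \<open>\<epsilon> / 8\<close> leaves it a share of \<open>\<epsilon> / 2\<close>.\<close>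
  obtain N where N: "lp_norm p (\<lambda>n. if n < N then 0 else x'' n) < \<epsilon> / 8"
    using order_tendstoD(2)[OF lp_tail_tendsto_0[OF p0 x''_lp], of "\<epsilon> / 8"] \<open>0 < \<epsilon>\<close>
    by (auto simp: eventually_sequentially)
  \<comment> \<open>Chosen so that the head of \<open>w''\<close>, with factor
    \<open>2 * \<eta> * N\<close>, also costs at most \<open>\<epsilon> / 2\<close>; the added ones
    avoid division by 0.\<close>
  define \<eta> where "\<eta> = \<epsilon> / (4 * (real N + 1) * (lp_norm p x'' + 1))"
  have pos: "0 < real N + 1" "0 < lp_norm p x'' + 1"
    using lp_norm_nonneg[of p x''] by linarith+
  have \<eta>: "0 < \<eta>" using \<open>0 < \<epsilon>\<close> pos by (simp add: \<eta>_def)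
  obtain Z where Z: "finite Z" "Z \<subseteq> K" "\<And>z. z \<in> K \<Longrightarrow> \<exists>w\<in>Z. \<forall>n<N. cmod (\<alpha> z n - \<alpha> w n) \<le> \<eta>"
    using finite_coefficient_net[of K \<alpha> \<eta> N] conjugate_ball_cmod_le_1[OF p \<alpha>] \<eta> by blast
  then obtain g where g: "\<And>z. z \<in> K \<Longrightarrow> g z \<in> Z" "\<And>z n. z \<in> K \<Longrightarrow> n < N \<Longrightarrow> cmod (\<alpha> z n - \<alpha> (g z) n) \<le> \<eta>"
    by metis
  have "x'' \<in> bidual_dominating p Z"
    using x'' Z(2) by (auto simp: bidual_dominating_def)
  then obtain u where u: "u \<in> lp p" "lp_norm p u \<le> lp_norm p x'' + \<epsilon>" "Z \<subseteq> p_co p u"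
    using finite_subset_p_co[OF p Z(1) _ \<open>0 < \<epsilon>\<close>] by blast
  define tail where "tail n = (if n < N then 0 else x'' n)" for n
  define head where "head n = (if n < N then x'' n else 0)" for n
  have tail: "tail \<in> lp p" "lp_norm p tail < \<epsilon> / 8"
    using lp_dominated(1)[OF x''_lp p0, of 1 tail] N by (auto simp: tail_def[abs_def])
  have head: "head \<in> lp p" "lp_norm p head \<le> lp_norm p x''"
    using lp_dominated[OF x''_lp p0, of 1 head] by (auto simp: head_def[abs_def])
  \<comment> \<open>The factors split the bound \<open>W\<close> as
    \<open>W / 2 + W / 4 + W / 4\<close>: the head sum has \<open>N\<close> terms, each at most
    \<open>W / (2 * N)\<close>, and Hoelder's inequality is used on the tail once for
    \<open>z\<close> and once for \<open>g z\<close>.\<close>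
  define w'' where "w'' n = (2 * \<eta> * N) *\<^sub>R head n + 4 *\<^sub>R tail n" for n
  have w''_lp: "w'' \<in> lp p" and w''_norm: "lp_norm p w'' \<le> \<epsilon>"
  proof -
    note hd = lp_scaleR[OF p0 head(1), of "2 * \<eta> * N"] and tl = lp_scaleR[OF p0 tail(1), of 4]
    show "w'' \<in> lp p"
      unfolding w''_def[abs_def] by (rule lp_add(1)[OF p hd(1) tl(1)])
    have "2 * \<eta> * N * lp_norm p head \<le> 2 * \<eta> * (real N + 1) * (lp_norm p x'' + 1)"
      using head(2) \<eta> by (intro mult_mono) auto
    also have "\<dots> = \<epsilon> / 2"
    proof -
      have "2 * (\<epsilon> / (4 * A * B)) * A * B = \<epsilon> / 2" if "0 < A" "0 < B" for A B
        using that by simp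
      from this[OF pos] show ?thesis by (simp only: \<eta>_def)
    qed
    finally show "lp_norm p w'' \<le> \<epsilon>"
      using lp_add(2)[OF p hd(1) tl(1)] hd(2) tl(2) tail(2) \<eta>
      unfolding w''_def[abs_def] by simp
  qed
  have "cmod (cblinfun_apply y' (z - g z)) \<le> lp_norm p (\<lambda>n. cblinfun_apply (w'' n) y')"
    if z: "z \<in> K" for z y'
  proof -
    define a where "a n = cblinfun_apply (x'' n) y'" for n
    define b where "b n = (if n < N then 0 else a n)" for n
    define W where "W = lp_norm p (\<lambda>n. cblinfun_apply (w'' n) y')"
    have a: "a \<in> lp p" unfolding a_def[abs_def] by (rule bidual_apply_lp(1)[OF p0 x''_lp])
    have b: "b \<in> lp p" by (rule lp_dominated(1)[OF a p0, of 1]) (auto simp: b_def)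
    have wW: "(\<lambda>n. cblinfun_apply (w'' n) y') \<in> lp p" by (rule bidual_apply_lp(1)[OF p0 w''_lp])
    have w''_apply: "cblinfun_apply (w'' n) y' = (if n < N then (2 * \<eta> * N) *\<^sub>R a n else 4 *\<^sub>R a n)" for n
      by (simp add: w''_def head_def tail_def a_def plus_cblinfun.rep_eq scaleR_cblinfun.rep_eq zero_cblinfun.rep_eq)
    have gz: "g z \<in> K" using g(1)[OF z] Z(2) by blast
    note Hz = Hoelder_conjugate_ball[OF p \<alpha>[OF z]] and Hg = Hoelder_conjugate_ball[OF p \<alpha>[OF gz]]
    have sums: "(\<lambda>n. \<alpha> w n * a n) sums cblinfun_apply y' w" if "w \<in> K" for w
      using Hoelder_conjugate_ball(1)[OF p \<alpha>[OF that] a]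
      unfolding rep[OF that] a_def[symmetric]
      by (intro summable_sums summable_norm_cancel[of "\<lambda>n. \<alpha> w n * a n"]) (simp add: norm_mult)
    have "(\<lambda>n. \<alpha> z n * a n - \<alpha> (g z) n * a n) sums (cblinfun_apply y' z - cblinfun_apply y' (g z))"
      by (intro sums_diff sums z gz)
    then have eq: "cblinfun_apply y' (z - g z) = (\<Sum>n. (\<alpha> z n - \<alpha> (g z) n) * a n)"
      by (simp add: sums_iff left_diff_distrib linear_diff[OF clinear_imp_linear[OF clinear_cblinfun]])
    \<comment> \<open>A termwise majorant: closeness of the coefficients below \<open>N\<close>, the
      triangle inequality from \<open>N\<close> on, where \<open>b\<close> agrees with
      \<open>a\<close>.\<close>
    define t where "t n = (if n < N then \<eta> * cmod (a n) else 0)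
      + (cmod (\<alpha> z n) * norm (b n) + cmod (\<alpha> (g z) n) * norm (b n))" for n
    have t_sums: "t sums ((\<Sum>n<N. \<eta> * cmod (a n))
        + ((\<Sum>n. cmod (\<alpha> z n) * norm (b n)) + (\<Sum>n. cmod (\<alpha> (g z) n) * norm (b n))))"
      unfolding t_def[abs_def]
      using sums_If_finite_set[of "{..<N}" "\<lambda>n. \<eta> * cmod (a n)"]
      by (intro sums_add summable_sums Hz(1)[OF b] Hg(1)[OF b]) simp
    have "norm ((\<alpha> z n - \<alpha> (g z) n) * a n) \<le> t n" for n
    proof (cases "n < N")
      case True
      then show ?thesis
        using g(2)[OF z True] by (simp add: t_def b_def norm_mult mult_right_mono)
    next
      case False
      have "cmod (\<alpha> z n - \<alpha> (g z) n) * cmod (a n) \<le> (cmod (\<alpha> z n) + cmod (\<alpha> (g z) n)) * cmod (a n)"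
        by (intro mult_right_mono norm_triangle_ineq4) simp
      then show ?thesis
        using False by (simp add: t_def b_def norm_mult distrib_right)
    qed
    then have "cmod (cblinfun_apply y' (z - g z)) \<le> suminf t"
      unfolding eq by (rule norm_suminf_le) (rule sums_summable[OF t_sums])
    also have "\<dots> \<le> (\<Sum>n<N. \<eta> * cmod (a n)) + (lp_norm p b + lp_norm p b)"
      using sums_unique[OF t_sums] Hz(2)[OF b] Hg(2)[OF b] by simp
    also have "(\<Sum>n<N. \<eta> * cmod (a n)) \<le> W / 2"
    proof -
      have "2 * real N * (\<Sum>n<N. \<eta> * cmod (a n)) = (\<Sum>n<N. norm (cblinfun_apply (w'' n) y'))"
        unfolding sum_distrib_left using \<eta> by (intro sum.cong refl) (simp add: w''_apply norm_mult)
      also have "\<dots> \<le> (\<Sum>n<N. W)"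
        unfolding W_def by (intro sum_mono norm_le_lp_norm wW p0)
      finally have "real N * (2 * (\<Sum>n<N. \<eta> * cmod (a n))) \<le> real N * W" by simp
      then show ?thesis
        by (cases "N = 0") (auto simp: W_def)
    qed
    also have "lp_norm p b \<le> W / 4"
    proof -
      have "norm (b n) \<le> 1 / 4 * norm (cblinfun_apply (w'' n) y')" for n
        by (simp add: b_def w''_apply)
      from lp_dominated(2)[OF wW p0 _ this] show ?thesis by (simp add: W_def)
    qed
    finally show ?thesis by (simp add: W_def)
  qed
  then have "w'' \<in> bidual_dominating p ((\<lambda>z. z - g z) ` K)"
    using w''_lp by (auto simp: bidual_dominating_def)
  then show thesis
    using that[OF u(1,2) _ _ w''_norm, of g] g(1) u(3) by blast
qed

text \<open>Domination is tested on a norming functional. This is what makes the residuals of the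
  iteration tend to 0.\<close>

lemma norm_le_bidual_dominating:
  fixes z :: "'a::complex_normed_vector"
  assumes "0 < p" "x'' \<in> bidual_dominating p K" "z \<in> K"
  shows "norm z \<le> lp_norm p x''"
proof -
  obtain y' :: "'a cdual" where y': "norm y' \<le> 1" "Re (cblinfun_apply y' z) = norm z"
    by (rule norming_functional)
  have "norm z \<le> cmod (cblinfun_apply y' z)"
    using complex_Re_le_cmod[of "cblinfun_apply y' z"] y'(2) by simp
  also have "\<dots> \<le> lp_norm p (\<lambda>n. cblinfun_apply (x'' n) y')"
    using assms by (simp add: bidual_dominating_def)
  also have "\<dots> \<le> norm y' * lp_norm p x''"
    using assms by (intro bidual_apply_lp) (auto simp: bidual_dominating_def)
  also have "\<dots> \<le> lp_norm p x''"
    using y'(1) by (simp add: mult_left_le_one_le)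
  finally show ?thesis .
qed

text \<open>\<open>bidual_dominating_step\<close> is iterated on the sets of residuals. Every point
  is the sum of its successive approximations, and \<open>p_co_countable_sum\<close> merges the
  sequences used at all stages.\<close>

theorem bidual_dominating_imp_p_co:
  fixes K :: "'a::complex_banach set"
  assumes p: "1 \<le> p" and x'': "x'' \<in> bidual_dominating p K" and "0 < \<epsilon>"
  obtains y where "y \<in> lp p" "lp_norm p y \<le> lp_norm p x'' + \<epsilon>" "K \<subseteq> p_co p y"
proof -
  \<comment> \<open>\<open>e i\<close> bounds a dominating sequence at stage \<open>i\<close>, and
    stage \<open>i\<close> costs \<open>e i + e (Suc i)\<close>. The values from index 1 on sum to
    \<open>\<epsilon> / 2\<close> and are counted twice, so the total is the norm of
    \<open>x''\<close> plus \<open>\<epsilon>\<close>.\<close>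
  define e where "e i = (if i = 0 then lp_norm p x'' else \<epsilon> / 2 * (1 / 2) ^ i)" for i :: nat
  have e_pos: "0 < e (Suc i)" "0 \<le> e i" for i
    using \<open>0 < \<epsilon>\<close> by (auto simp: e_def)
  define dom where "dom L c \<longleftrightarrow> (\<exists>w''\<in>bidual_dominating p L. lp_norm p w'' \<le> c)" for L :: "'a set" and c
  define step where "step i L u g \<longleftrightarrow> u \<in> lp p \<and> lp_norm p u \<le> e i + e (Suc i)
      \<and> (\<forall>z\<in>L. g z \<in> p_co p u) \<and> dom ((\<lambda>z. z - g z) ` L) (e (Suc i))" for i L u g
  have ex: "\<exists>ug. step i L (fst ug) (snd ug)" if "dom L (e i)" for i L
  proof -
    from that obtain w'' where w'': "w'' \<in> bidual_dominating p L" "lp_norm p w'' \<le> e i"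
      by (auto simp: dom_def)
    obtain u g v'' where ug: "u \<in> lp p" "lp_norm p u \<le> lp_norm p w'' + e (Suc i)"
        "\<And>z. z \<in> L \<Longrightarrow> g z \<in> p_co p u"
      and v'': "v'' \<in> bidual_dominating p ((\<lambda>z. z - g z) ` L)" "lp_norm p v'' \<le> e (Suc i)"
      using bidual_dominating_step[OF p w''(1) e_pos(1)[of i]] by blast
    have "lp_norm p u \<le> e i + e (Suc i)" using ug(2) w''(2) by simp
    moreover have "dom ((\<lambda>z. z - g z) ` L) (e (Suc i))" using v'' by (auto simp: dom_def)
    ultimately have "step i L u g" using ug(1,3) unfolding step_def by blast
    then show ?thesis by force
  qed
  \<comment> \<open>Choosing for every stage and set at once makes the iteration a plain
    recursion.\<close>
  define ug where "ug i L = (SOME ug. step i L (fst ug) (snd ug))" for i L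
  define u where "u i L = fst (ug i L)" for i L
  define g where "g i L = snd (ug i L)" for i L
  have "step i L (u i L) (g i L)" if "dom L (e i)" for i L
    unfolding u_def g_def ug_def by (rule someI_ex[OF ex[OF that]])
  then have ug: "u i L \<in> lp p" "lp_norm p (u i L) \<le> e i + e (Suc i)"
      "\<And>z. z \<in> L \<Longrightarrow> g i L z \<in> p_co p (u i L)" "dom ((\<lambda>z. z - g i L z) ` L) (e (Suc i))"
    if "dom L (e i)" for i L
    using that unfolding step_def by blast+
  \<comment> \<open>The set of residuals of all points of \<open>K\<close> after \<open>i\<close>
    steps.\<close>
  define R where "R = rec_nat K (\<lambda>i L. (\<lambda>z. z - g i L z) ` L)"
  have R_Suc: "R (Suc i) = (\<lambda>z. z - g i (R i) z) ` R i" for i by (simp add: R_def)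
  have R: "dom (R i) (e i)" for i
  proof (induction i)
    case 0
    show ?case using x'' by (auto simp: R_def e_def dom_def)
  next
    case (Suc i)
    then show ?case using ug(4)[of "R i" i] by (simp add: R_Suc)
  qed
  \<comment> \<open>The residual of a single point, which stays in \<open>R i\<close>.\<close>
  define f where "f z = rec_nat z (\<lambda>i x. x - g i (R i) x)" for z
  have f_R: "f z i \<in> R i" if "z \<in> K" for z i
    by (induction i) (use that in \<open>auto simp: f_def R_def\<close>)
  have "(\<lambda>i. e (Suc i)) sums (\<epsilon> / 2 * 1)"
    unfolding e_def using sums_mult[OF power_half_series, of "\<epsilon> / 2"] by simp
  moreover from this have "e sums (\<epsilon> / 2 * 1 + e 0)"
    by (simp add: sums_Suc_iff)
  ultimately have "(\<lambda>i. e i + e (Suc i)) sums (\<epsilon> / 2 * 1 + e 0 + \<epsilon> / 2 * 1)"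
    by (intro sums_add)
  then have sums: "(\<lambda>i. e i + e (Suc i)) sums (lp_norm p x'' + \<epsilon>)"
    by (simp add: e_def add_ac)
  have e_0: "e \<longlonglongrightarrow> 0"
    by (rule summable_LIMSEQ_zero[OF sums_summable[OF \<open>e sums (\<epsilon> / 2 * 1 + e 0)\<close>]])
  have pos: "0 < e i + e (Suc i)" for i
    using e_pos[of i] by simp
  obtain y where y: "y \<in> lp p" "lp_norm p y \<le> lp_norm p x'' + \<epsilon>"
    "\<And>a. (\<And>i. a i \<in> p_co p (u i (R i))) \<Longrightarrow> suminf a \<in> p_co p y"
    using p_co_countable_sum[where u = "\<lambda>i. u i (R i)", OF p ug(1,2)[OF R] pos sums] by blast
  show thesis
  proof (rule that[OF y(1,2)], rule subsetI)
    fix z assume z: "z \<in> K"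
    define a where "a i = g i (R i) (f z i)" for i
    have "suminf a \<in> p_co p y"
      by (rule y(3)) (simp add: a_def ug(3)[OF R] f_R[OF z])
    moreover have "a sums z"
    proof -
      \<comment> \<open>The partial sums telescope.\<close>
      have "(\<Sum>i<n. a i) = z - f z n" for n
        by (induction n) (auto simp: f_def a_def)
      moreover have "(\<lambda>n. f z n) \<longlonglongrightarrow> 0"
      proof (rule Lim_null_comparison[OF _ e_0], rule always_eventually, rule allI)
        fix n
        obtain w'' where "w'' \<in> bidual_dominating p (R n)" "lp_norm p w'' \<le> e n"
          using R[of n] by (auto simp: dom_def)
        then show "norm (f z n) \<le> e n"
          using norm_le_bidual_dominating[of p w'' "R n" "f z n"] f_R[OF z, of n] p by simp
      qed
      ultimately show ?thesis
        unfolding sums_def using tendsto_diff[OF tendsto_const[of z], of "f z" 0] by simp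
    qed
    ultimately show "z \<in> p_co p y" by (simp add: sums_iff)
  qed
qed

section \<open>The canonical embedding into the bidual and the transpose\<close>

lift_definition bidual_embedding :: "'a::complex_normed_vector \<Rightarrow> 'a cdual cdual"
  is "\<lambda>x y'. cblinfun_apply y' x"
proof (intro conjI)
  fix x :: 'a
  show cl: "clinear (\<lambda>y' :: 'a cdual. cblinfun_apply y' x)"
    by (simp add: clinear_def plus_cblinfun.rep_eq scaleC_cblinfun.rep_eq)
  show "bounded_linear (\<lambda>y' :: 'a cdual. cblinfun_apply y' x)"
    by (intro bounded_linear.intro bounded_linear_axioms.intro clinear_imp_linear cl)
      (use norm_cblinfun_apply in blast)
qed

lemma norm_bidual_embedding_le: "norm (bidual_embedding x) \<le> norm x"
  by (rule norm_cblinfun_leI)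
    (simp_all add: bidual_embedding.rep_eq norm_cblinfun_apply mult.commute[of "norm x"])

text \<open>The embedded vectors \<open>y n\<close> dominate every point of \<open>p_co p y\<close>
  by Hoelder's inequality. For fixed \<open>y'\<close> the inequality is a closed condition on the
  point, so it extends to the closure.\<close>

lemma closure_p_co_imp_bidual_dominating:
  fixes K :: "'a::complex_banach set"
  assumes p: "1 \<le> p" and y: "y \<in> lp p" and K: "K \<subseteq> closure (p_co p y)"
  obtains x'' where "x'' \<in> bidual_dominating p K" "lp_norm p x'' \<le> lp_norm p y"
proof -
  have p0: "0 < p" using p by simp
  define x'' where "x'' n = bidual_embedding (y n)" for n
  have x'': "x'' \<in> lp p" "lp_norm p x'' \<le> lp_norm p y"
    using lp_dominated[OF y p0, of 1 x''] by (auto simp: x''_def norm_bidual_embedding_le)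
  have "cmod (cblinfun_apply y' z) \<le> lp_norm p (\<lambda>n. cblinfun_apply (x'' n) y')" if "z \<in> K" for z y'
  proof -
    let ?S = "{z. cmod (cblinfun_apply y' z) \<le> lp_norm p (\<lambda>n. cblinfun_apply (x'' n) y')}"
    have "p_co p y \<subseteq> ?S"
    proof
      fix w assume "w \<in> p_co p y"
      then obtain \<alpha> where \<alpha>: "\<alpha> \<in> conjugate_ball p" "w = (\<Sum>n. \<alpha> n *\<^sub>C y n)"
        by (auto simp: p_co_def)
      have "cblinfun_apply y' w = (\<Sum>n. cblinfun_apply y' (\<alpha> n *\<^sub>C y n))"
        unfolding \<alpha>(2)
        by (intro bounded_linear.suminf[OF bounded_linear_cblinfun]
            summable_norm_cancel[OF summable_norm_scaleC_conjugate_ball[OF p \<alpha>(1) y]])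
      also have "\<dots> = (\<Sum>n. \<alpha> n *\<^sub>C cblinfun_apply (x'' n) y')"
        by (simp add: cblinfun_apply_scaleC x''_def bidual_embedding.rep_eq)
      finally show "w \<in> ?S"
        using norm_suminf_conjugate_ball[OF p \<alpha>(1) bidual_apply_lp(1)[OF p0 x''(1), of y']] by simp
    qed
    moreover have "closed ?S"
      by (intro closed_Collect_le continuous_intros
          linear_continuous_on bounded_linear_cblinfun)
    ultimately have "closure (p_co p y) \<subseteq> ?S" by (rule closure_minimal)
    with K that show ?thesis by blast
  qed
  then show thesis
    using that[of x''] x'' by (auto simp: bidual_dominating_def)
qed

text \<open>The norm of a scalar polynomial is a supremum over the unit ball, so a bound on it is a
  bound at each point of the image of the ball.\<close>

lemma quasi_nuclear_dominating_poly_transpose: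
  "quasi_nuclear_dominating p (poly_transpose P) = bidual_dominating p (poly_apply P ` cball 0 1)"
proof -
  have "norm (cblinfun_apply (poly_transpose P) y') \<le> c
      \<longleftrightarrow> (\<forall>x\<in>cball 0 1. cmod (cblinfun_apply y' (poly_apply P x)) \<le> c)" for y' c
    using order_trans[OF norm_hom_poly_upper[of _ "poly_compose y' P"], of _ c]
      norm_hom_poly_least[of "poly_compose y' P" c]
    by (auto simp: poly_transpose.rep_eq poly_compose.rep_eq)
  then show ?thesis
    by (auto simp: quasi_nuclear_dominating_def bidual_dominating_def)
qed

theorem corollary2p5:
  fixes P :: "('m::finite, 'a::complex_banach, 'b::complex_banach) hom_poly"
    and p :: real
  assumes "1 \<le> p"
  shows "(p_compact_poly p P \<longleftrightarrow> quasi_p_nuclear p (poly_transpose P))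
    \<and> kappa_p p P = nu_p_Q p (poly_transpose P)"
proof -
  define K where "K = poly_apply P ` cball 0 1"
  \<comment> \<open>Relative compactness involves the closure of the hull while \<open>m_p\<close>
    uses the hull itself. Both are compared with \<open>bidual_dominating p K\<close>: the closure
    is enough to produce a dominating sequence, and a dominating sequence gives inclusion in the
    hull itself.\<close>
  have "relatively_p_compact p K \<longleftrightarrow> bidual_dominating p K \<noteq> {}"
  proof
    assume "relatively_p_compact p K"
    then obtain y where "y \<in> lp p" "K \<subseteq> closure (p_co p y)"
      by (auto simp: relatively_p_compact_def)
    then show "bidual_dominating p K \<noteq> {}"
      using closure_p_co_imp_bidual_dominating[OF assms] by blast
  next
    assume "bidual_dominating p K \<noteq> {}"
    then obtain x'' where "x'' \<in> bidual_dominating p K" by blast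
    then obtain y where "y \<in> lp p" "K \<subseteq> p_co p y"
      using bidual_dominating_imp_p_co[OF assms, of x'' K 1] by auto
    then show "relatively_p_compact p K"
      using closure_subset by (force simp: relatively_p_compact_def)
  qed
  moreover have "m_p p K = (INF x'' \<in> bidual_dominating p K. ennreal (lp_norm p x''))"
  proof (rule antisym)
    show "m_p p K \<le> (INF x'' \<in> bidual_dominating p K. ennreal (lp_norm p x''))"
    proof (rule INF_greatest)
      fix x'' assume x'': "x'' \<in> bidual_dominating p K"
      show "m_p p K \<le> ennreal (lp_norm p x'')"
      proof (rule ennreal_le_epsilon)
        fix e :: real assume "0 < e"
        obtain y where y: "y \<in> lp p" "lp_norm p y \<le> lp_norm p x'' + e" "K \<subseteq> p_co p y"
          using bidual_dominating_imp_p_co[OF assms x'' \<open>0 < e\<close>] .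
        have "m_p p K \<le> ennreal (lp_norm p y)"
          unfolding m_p_def by (rule INF_lower) (use y in simp)
        also have "\<dots> \<le> ennreal (lp_norm p x'') + ennreal e"
          using y(2) \<open>0 < e\<close> by (simp add: ennreal_plus[symmetric] ennreal_leI del: ennreal_plus)
        finally show "m_p p K \<le> ennreal (lp_norm p x'') + ennreal e" .
      qed
    qed
    show "(INF x'' \<in> bidual_dominating p K. ennreal (lp_norm p x'')) \<le> m_p p K"
      unfolding m_p_def
    proof (rule INF_greatest)
      fix y assume "y \<in> {y \<in> lp p. K \<subseteq> p_co p y}"
      then have "y \<in> lp p" "K \<subseteq> closure (p_co p y)"
        using closure_subset[of "p_co p y"] by auto
      then obtain x'' where "x'' \<in> bidual_dominating p K" "lp_norm p x'' \<le> lp_norm p y"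
        using closure_p_co_imp_bidual_dominating[OF assms] by blast
      then show "(INF x'' \<in> bidual_dominating p K. ennreal (lp_norm p x'')) \<le> ennreal (lp_norm p y)"
        by (intro INF_lower2) (auto intro: ennreal_leI)
    qed
  qed
  ultimately show ?thesis
    by (simp add: p_compact_poly_def quasi_p_nuclear_def kappa_p_def nu_p_Q_def
        quasi_nuclear_dominating_poly_transpose K_def)
qed

end
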